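(* Let $E_6$ be the simply connected compact Lie group of type $E_6$ realized on $\mathfrak J^C$ as in the context, let $\sigma,\gamma\in F_4\subset E_6$ be the two commuting involutions defined in the context, and let $(E_6)^{\sigma,\gamma}=\{\alpha\in E_6 : \sigma\alpha=\alpha\sigma,\ \gamma\alpha=\alpha\gamma\}$. Then $$(E_6)^{\sigma,\gamma}\cong (Sp(1)\times S(U(2)\times U(4)))/\mathbf Z_2,\qquad \mathbf Z_2=\{(1,E),(-1,-E)\}.$$
   Context: Let $\mathbf H$ be the quaternions and $\mathfrak C=\mathbf H\oplus\mathbf He_4$ the Cayley (division octonion) algebra with product $(m+ae_4)(n+be_4)=(mn-\bar ba)+(a\bar n+bm)e_4$ and conjugation $\overline{m+ae_4}=\bar m-ae_4$. For a real vector space $V$, $V^C=\{u+iv:u,v\in V\}$ is its complexification, $\tau(u+iv)=u-iv$, and $C=\mathbf R^C$. Let $\mathfrak J^C=\{X\in M(3,\mathfrak C^C): X^*=X\}$ (octonionic conjugation extended $C$-linearly); write $X=\begin{pmatrix}\xi_1&x_3&\bar x_2\\ \bar x_3&\xi_2&x_1\\ x_2&\bar x_1&\xi_3\end{pmatrix}$, $\xi_k\in C$, $x_k\in\mathfrak C^C$. Put $X\circ Y=\frac12(XY+YX)$, $(X,Y)=\mathrm{tr}(X\circ Y)$, $X\times Y=\frac12\big(2X\circ Y-\mathrm{tr}(X)Y-\mathrm{tr}(Y)X+(\mathrm{tr}(X)\mathrm{tr}(Y)-(X,Y))E\big)$, $\langle X,Y\rangle=(\tau X,Y)$. Define $E_6=\{\alpha\in\mathrm{Iso}_C(\mathfrak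 J^C): \alpha X\times\alpha Y=\tau\alpha\tau(X\times Y),\ \langle\alpha X,\alpha Y\rangle=\langle X,Y\rangle\}$. The $C$-linear map $\sigma$ replaces $(x_1,x_2,x_3)$ by $(x_1,-x_2,-x_3)$ and fixes the $\xi_k$; the $C$-linear map $\gamma$ fixes the $\xi_k$ and replaces each $x_k=m_k+a_ke_4$ ($m_k,a_k\in\mathbf H^C$) by $m_k-a_ke_4$. Both lie in $E_6$. $S(U(2)\times U(4))$ is the subgroup of $SU(6)$ of block-diagonal matrices with blocks of sizes $2$ and $4$; $E$ is the identity matrix. $\cong$ denotes isomorphism of (Lie) groups. *)

theory Defs
  imports "HOL-Analysis.Analysis" "HOL-Algebra.Coset" "HOL-Algebra.Bij"
begin

section \<open>Quaternions and Cayley algebra\<close>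

text \<open>
  Everything is built on nested products of \<open>real\<close>, so that additive structure, real scaling,
  norm and topology are the library instances for products and vectors.
  The quadruple \<open>(a, b, c, d)\<close> is the quaternion \<open>a + b i + c j + d k\<close>.
\<close>

type_synonym quat = "real \<times> real \<times> real \<times> real"

fun qmul :: "quat \<Rightarrow> quat \<Rightarrow> quat" where
  "qmul (a, b, c, d) (a', b', c', d') =
     (a * a' - b * b' - c * c' - d * d',
      a * b' + b * a' + c * d' - d * c',
      a * c' - b * d' + c * a' + d * b',
      a * d' + b * c' - c * b' + d * a')"

fun qcnj :: "quat \<Rightarrow> quat" where
  "qcnj (a, b, c, d) = (a, - b, - c, - d)"

definition qone :: quat where
  "qone = (1, 0, 0, 0)"

text \<open>The pair \<open>(m, a)\<close> is the octonion \<open>m + a e\<^sub>4\<close>.\<close>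

type_synonym cayley = "quat \<times> quat"

fun omul :: "cayley \<Rightarrow> cayley \<Rightarrow> cayley" where
  "omul (m, a) (n, b) = (qmul m n - qmul (qcnj b) a, qmul a (qcnj n) + qmul b m)"

fun ocnj :: "cayley \<Rightarrow> cayley" where
  "ocnj (m, a) = (qcnj m, - a)"

fun ogamma :: "cayley \<Rightarrow> cayley" where
  "ogamma (m, a) = (m, - a)"


section \<open>Complexification\<close>

text \<open>The pair \<open>(u, v)\<close> is \<open>u + i v\<close>; \<open>clin f\<close> and \<open>cbilin f\<close> are the \<open>C\<close>-(bi)linear extensions of
  real (bi)linear maps.\<close>

type_synonym 'v cpx = "'v \<times> 'v"

fun cscale :: "complex \<Rightarrow> ('v::real_vector) cpx \<Rightarrow> 'v cpx" where
  "cscale z (u, v) = (Re z *\<^sub>R u - Im z *\<^sub>R v, Re z *\<^sub>R v + Im z *\<^sub>R u)"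

fun clin :: "('v \<Rightarrow> 'w) \<Rightarrow> 'v cpx \<Rightarrow> 'w cpx" where
  "clin f (u, v) = (f u, f v)"

fun cbilin :: "('v \<Rightarrow> 'w \<Rightarrow> 'x::real_vector) \<Rightarrow> 'v cpx \<Rightarrow> 'w cpx \<Rightarrow> 'x cpx" where
  "cbilin f (u, v) (u', v') = (f u u' - f v v', f u v' + f v u')"

fun ctau :: "('v::real_vector) cpx \<Rightarrow> 'v cpx" where
  "ctau (u, v) = (u, - v)"

type_synonym cayleyC = "cayley cpx"

abbreviation cmul :: "cayleyC \<Rightarrow> cayleyC \<Rightarrow> cayleyC" where
  "cmul \<equiv> cbilin omul"

abbreviation ccnj :: "cayleyC \<Rightarrow> cayleyC" where
  "ccnj \<equiv> clin ocnj"

text \<open>The inclusion of \<open>C = R\<^sup>C\<close>, for which we use the type \<open>complex\<close>, and its left inverse,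
  which extracts the coefficient of the unit.\<close>

definition of_scal :: "complex \<Rightarrow> cayleyC" where
  "of_scal z = (((Re z, 0, 0, 0), 0), ((Im z, 0, 0, 0), 0))"

fun scal :: "cayleyC \<Rightarrow> complex" where
  "scal (((a, _), _), ((b, _), _)) = Complex a b"


section \<open>The complex exceptional Jordan algebra\<close>

type_synonym matC = "cayleyC ^ 3 ^ 3"

definition mmul :: "matC \<Rightarrow> matC \<Rightarrow> matC" where
  "mmul X Y = (\<chi> i j. \<Sum>k\<in>UNIV. cmul (X $ i $ k) (Y $ k $ j))"

definition mscale :: "complex \<Rightarrow> matC \<Rightarrow> matC" where
  "mscale z X = (\<chi> i j. cscale z (X $ i $ j))"

definition mstar :: "matC \<Rightarrow> matC" where
  "mstar X = (\<chi> i j. ccnj (X $ j $ i))"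

definition mE :: matC where
  "mE = (\<chi> i j. if i = j then of_scal 1 else 0)"

definition jordanC :: "matC set" where
  "jordanC = {X. mstar X = X}"

text \<open>On \<open>jordanC\<close> the diagonal entries lie in \<open>C\<close>, so \<open>scal\<close> loses nothing.\<close>

definition jtr :: "matC \<Rightarrow> complex" where
  "jtr X = scal (\<Sum>k\<in>UNIV. X $ k $ k)"

definition jprod :: "matC \<Rightarrow> matC \<Rightarrow> matC" where
  "jprod X Y = mscale (1/2) (mmul X Y + mmul Y X)"

definition jform :: "matC \<Rightarrow> matC \<Rightarrow> complex" where
  "jform X Y = jtr (jprod X Y)"

definition jcross :: "matC \<Rightarrow> matC \<Rightarrow> matC" where
  "jcross X Y = mscale (1/2)
     (mscale 2 (jprod X Y) - mscale (jtr X) Y - mscale (jtr Y) X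
      + mscale (jtr X * jtr Y - jform X Y) mE)"

definition jtau :: "matC \<Rightarrow> matC" where
  "jtau X = (\<chi> i j. ctau (X $ i $ j))"

definition jherm :: "matC \<Rightarrow> matC \<Rightarrow> complex" where
  "jherm X Y = jform (jtau X) Y"

definition jmat :: "complex \<Rightarrow> complex \<Rightarrow> complex \<Rightarrow> cayleyC \<Rightarrow> cayleyC \<Rightarrow> cayleyC \<Rightarrow> matC" where
  "jmat \<xi>1 \<xi>2 \<xi>3 x1 x2 x3 = vector
     [vector [of_scal \<xi>1, x3, ccnj x2],
      vector [ccnj x3, of_scal \<xi>2, x1],
      vector [x2, ccnj x1, of_scal \<xi>3]]"

lemma of_scal_scal_iff: "of_scal (scal x) = x \<longleftrightarrow> ccnj x = x"
proof -
  have "\<forall>x. of_scal (scal x) = x \<longleftrightarrow> ccnj x = x"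
    by (simp only: split_paired_All) (auto simp: of_scal_def zero_prod_def)
  then show ?thesis by blast
qed

lemma ccnj_of_scal [simp]: "ccnj (of_scal z) = of_scal z"
  by (simp add: of_scal_def)

lemma ccnj_ccnj [simp]: "ccnj (ccnj x) = x"
proof -
  have "\<forall>x. ccnj (ccnj x) = x"
    by (simp only: split_paired_All) simp
  then show ?thesis by blast
qed

lemma jmat_in_jordanC: "jmat \<xi>1 \<xi>2 \<xi>3 x1 x2 x3 \<in> jordanC"
  by (simp add: jordanC_def jmat_def mstar_def vec_eq_iff forall_3)

lemma jordanC_jmat:
  assumes "X \<in> jordanC"
  shows "jmat (scal (X$1$1)) (scal (X$2$2)) (scal (X$3$3)) (X$2$3) (X$3$1) (X$1$2) = X"
proof -
  have "ccnj (X$j$i) = X$i$j" for i j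
    using assms by (simp add: jordanC_def mstar_def vec_eq_iff)
  then show ?thesis
    by (simp add: jmat_def vec_eq_iff forall_3 of_scal_scal_iff)
qed

text \<open>By the preceding lemma the following are the maps given in the coordinates
  \<open>(\<xi>\<^sub>1, \<xi>\<^sub>2, \<xi>\<^sub>3, x\<^sub>1, x\<^sub>2, x\<^sub>3)\<close>; they are meaningful on \<open>jordanC\<close> only.\<close>

definition jsigma :: "matC \<Rightarrow> matC" where
  "jsigma X = jmat (scal (X$1$1)) (scal (X$2$2)) (scal (X$3$3))
     (X$2$3) (- (X$3$1)) (- (X$1$2))"

definition jgamma :: "matC \<Rightarrow> matC" where
  "jgamma X = jmat (scal (X$1$1)) (scal (X$2$2)) (scal (X$3$3))
     (clin ogamma (X$2$3)) (clin ogamma (X$3$1)) (clin ogamma (X$1$2))"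


section \<open>The group \<open>E\<^sub>6\<close> and its fixed-point subgroup\<close>

definition IsoC :: "(matC \<Rightarrow> matC) set" where
  "IsoC = {\<alpha> \<in> Bij jordanC.
     (\<forall>X\<in>jordanC. \<forall>Y\<in>jordanC. \<alpha> (X + Y) = \<alpha> X + \<alpha> Y) \<and>
     (\<forall>z. \<forall>X\<in>jordanC. \<alpha> (mscale z X) = mscale z (\<alpha> X))}"

definition E6_set :: "(matC \<Rightarrow> matC) set" where
  "E6_set = {\<alpha> \<in> IsoC. \<forall>X\<in>jordanC. \<forall>Y\<in>jordanC.
     jcross (\<alpha> X) (\<alpha> Y) = jtau (\<alpha> (jtau (jcross X Y))) \<and>
     jherm (\<alpha> X) (\<alpha> Y) = jherm X Y}"

definition E6 :: "(matC \<Rightarrow> matC) monoid" where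
  "E6 = (BijGroup jordanC)\<lparr>carrier := E6_set\<rparr>"

definition E6_sigma_gamma :: "(matC \<Rightarrow> matC) monoid" where
  "E6_sigma_gamma = E6\<lparr>carrier := {\<alpha> \<in> carrier E6. \<forall>X\<in>jordanC.
     jsigma (\<alpha> X) = \<alpha> (jsigma X) \<and> jgamma (\<alpha> X) = \<alpha> (jgamma X)}\<rparr>"


section \<open>\<open>Sp(1)\<close> and \<open>S(U(2) \<times> U(4))\<close>\<close>

definition Sp1 :: "quat monoid" where
  "Sp1 = \<lparr>carrier = {p. qmul (qcnj p) p = qone}, mult = qmul, one = qone\<rparr>"

text \<open>The six rows and columns are indexed by the sum type \<open>2 + 4\<close>,
  whose summands \<open>Inl\<close> and \<open>Inr\<close> are the two diagonal blocks.\<close>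

type_synonym mat6 = "complex ^ (2 + 4) ^ (2 + 4)"

definition adjoint_mat :: "complex ^ 'n ^ 'n \<Rightarrow> complex ^ 'n ^ 'n" where
  "adjoint_mat A = (\<chi> i j. cnj (A $ j $ i))"

definition SU6 :: "mat6 monoid" where
  "SU6 = \<lparr>carrier = {A. adjoint_mat A ** A = mat 1 \<and> det A = 1}, mult = (**), one = mat 1\<rparr>"

definition S_U2_U4 :: "mat6 monoid" where
  "S_U2_U4 = SU6\<lparr>carrier := {A \<in> carrier SU6.
     \<forall>i j. A $ Inl i $ Inr j = 0 \<and> A $ Inr j $ Inl i = 0}\<rparr>"

definition Z2 :: "(quat \<times> mat6) set" where
  "Z2 = {(qone, mat 1), (- qone, - mat 1)}"


section \<open>Topologies\<close>

text \<open>The quotient topology on the set of cosets: a set of cosets is open iff its union is.\<close>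

definition coset_topology :: "('a, 'b) monoid_scheme \<Rightarrow> 'a set \<Rightarrow> 'a topology \<Rightarrow> 'a set topology" where
  "coset_topology G N T = topology (\<lambda>U. U \<subseteq> carrier (G Mod N) \<and> openin T (\<Union>U))"

lemma openin_coset_topology:
  assumes "group G" "subgroup N G"
  shows "openin (coset_topology G N T) U \<longleftrightarrow> U \<subseteq> carrier (G Mod N) \<and> openin T (\<Union>U)"
proof -
  have disj: "A = B" if "A \<in> carrier (G Mod N)" "B \<in> carrier (G Mod N)" "x \<in> A" "x \<in> B" for A B x
    using group.rcos_disjoint[OF assms] that
    by (auto simp: FactGroup_def pairwise_def disjnt_def)
  have "istopology (\<lambda>U. U \<subseteq> carrier (G Mod N) \<and> openin T (\<Union>U))"
    unfolding istopology_def
  proof (intro conjI allI impI)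
    fix U V
    assume U: "U \<subseteq> carrier (G Mod N) \<and> openin T (\<Union>U)"
      and V: "V \<subseteq> carrier (G Mod N) \<and> openin T (\<Union>V)"
    then have "\<Union>(U \<inter> V) = \<Union>U \<inter> \<Union>V"
      using disj by blast
    with U V show "openin T (\<Union>(U \<inter> V))" by auto
    show "U \<inter> V \<subseteq> carrier (G Mod N)" using U by blast
  next
    fix \<K>
    assume K: "\<forall>U\<in>\<K>. U \<subseteq> carrier (G Mod N) \<and> openin T (\<Union>U)"
    then show "\<Union>\<K> \<subseteq> carrier (G Mod N)" by blast
    have "\<Union>(\<Union>\<K>) = \<Union>(Union ` \<K>)" by blast
    with K show "openin T (\<Union>(\<Union>\<K>))" by auto
  qed
  then show ?thesis
    by (simp add: coset_topology_def topology_inverse')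
qed

text \<open>
  \<open>lie_iso\<close> is isomorphism of topological groups; between Lie groups every continuous homomorphism
  is smooth, so for Lie groups this is isomorphism of Lie groups.
\<close>

definition lie_iso ::
  "('a, 'c) monoid_scheme \<Rightarrow> 'a topology \<Rightarrow> ('b, 'd) monoid_scheme \<Rightarrow> 'b topology \<Rightarrow> bool" where
  "lie_iso G T H S \<longleftrightarrow> (\<exists>h \<in> iso G H. homeomorphic_map T S h)"

text \<open>
  \<open>top_of_set (carrier E6_sigma_gamma)\<close> refers to the product topology on functions, i.e. pointwise
  convergence; on linear maps of the finite-dimensional space \<open>jordanC\<close> it is the usual topology.
\<close>

end

theory Submission
  imports Defs
begin

text \<open>
  The complex quaternions are \<open>2 \<times> 2\<close> complex matrices, so a Hermitian \<open>3 \<times> 3\<close> matrix over them,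
  multiplied by three diagonal copies of \<open>eps2\<close>, is a skew matrix \<open>S\<close> of size 6, and the three
  \<open>e\<^sub>4\<close>-components of an element of \<open>jordanC\<close> form a \<open>2 \<times> 6\<close> matrix \<open>v\<close>. In these coordinates the
  determinant of the Jordan algebra is \<open>Pf S - (v S v\<^sup>T)\<^sub>1\<^sub>2\<close>, and \<open>p \<in> Sp(1)\<close>, \<open>A \<in> SU(6)\<close> act by
  \<open>S \<mapsto> A S A\<^sup>T\<close>, \<open>v \<mapsto> p v A\<^sup>*\<close>. As \<open>E\<^sub>6\<close> is the group of the linear maps that preserve the determinant
  and the Hermitian form, this is a homomorphism into \<open>E\<^sub>6\<close>. Splitting 6 as 2 + 4 gives blocks
  \<open>S = (t, x, w)\<close> and \<open>v = (y, z)\<close>, where \<open>(t, w)\<close>, \<open>x\<close>, \<open>y\<close>, \<open>z\<close>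
  are the joint eigenspaces of \<open>\<sigma>\<close> and \<open>\<gamma>\<close>.

  Surjectivity needs no Lie theory. A map \<open>\<alpha>\<close> commuting with \<open>\<sigma>\<close> and \<open>\<gamma>\<close> acts on these
  eigenspaces separately. The term of the determinant that is trilinear in \<open>x, y, z\<close> pairs \<open>z\<close> with \<open>y x\<close>,
  so invariance yields \<open>f\<^sub>x (y x) = h y (f\<^sub>x x)\<close> with \<open>h y = (f\<^sub>y 1)\<^sup>-\<^sup>1 (f\<^sub>y y)\<close>. An intertwiner \<open>q\<close> with
  \<open>h y = q y q\<^sup>-\<^sup>1\<close> can be read off from \<open>f\<^sub>x\<close>, hence \<open>f\<^sub>x x = B x C\<^sup>T\<close> and \<open>f\<^sub>y y = P y B\<^sup>*\<close>, with unitary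
  factors because \<open>\<alpha>\<close> is unitary. The remaining terms of the determinant fix the action on
  \<open>z\<close>, \<open>t\<close>, \<open>w\<close> and force \<open>det B det C = 1\<close>.
\<close>

section \<open>Octonions in matrix coordinates\<close>

text \<open>The octonion \<open>m + a e\<^sub>4\<close> with \<open>m = (a b; c d)\<close> and \<open>a = (e f; g h)\<close>, where the quaternion units are
  the matrices \<open>i = (\<i> 0; 0 -\<i>)\<close>, \<open>j = (0 1; -1 0)\<close>, \<open>k = (0 \<i>; \<i> 0)\<close>.\<close>

definition oct8 :: "complex \<Rightarrow> complex \<Rightarrow> complex \<Rightarrow> complex \<Rightarrow> complex \<Rightarrow> complex \<Rightarrow> complex \<Rightarrow> complex \<Rightarrow> cayleyC" where
  "oct8 a b c d e f g h =
    ((((Re a + Re d) / 2, (Im a - Im d) / 2, (Re b - Re c) / 2, (Im b + Im c) / 2),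
      ((Re e + Re h) / 2, (Im e - Im h) / 2, (Re f - Re g) / 2, (Im f + Im g) / 2)),
     (((Im a + Im d) / 2, (Re d - Re a) / 2, (Im b - Im c) / 2, - (Re b + Re c) / 2),
      ((Im e + Im h) / 2, (Re h - Re e) / 2, (Im f - Im g) / 2, - (Re f + Re g) / 2)))"

lemma oct8_surj: "\<exists>a b c d e f g h. w = oct8 a b c d e f g h"
proof -
  obtain q0 q1 q2 q3 r0 r1 r2 r3 s0 s1 s2 s3 t0 t1 t2 t3 where
    w: "w = (((q0,q1,q2,q3),(r0,r1,r2,r3)),((s0,s1,s2,s3),(t0,t1,t2,t3)))"
    by (metis surj_pair)
  \<comment> \<open>With complexified coefficients \<open>Q0 = q0 + \<i> s0\<close> and so on, the
    matrix entries of a complex quaternion are \<open>Q0 + \<i> Q1\<close>,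
    \<open>Q2 + \<i> Q3\<close>, \<open>- Q2 + \<i> Q3\<close>, \<open>Q0 - \<i> Q1\<close>.\<close>
  have "w = oct8 (Complex (q0 - s1) (s0 + q1)) (Complex (q2 - s3) (s2 + q3))
       (Complex (- q2 - s3) (q3 - s2)) (Complex (q0 + s1) (s0 - q1))
       (Complex (r0 - t1) (t0 + r1)) (Complex (r2 - t3) (t2 + r3))
       (Complex (- r2 - t3) (r3 - t2)) (Complex (r0 + t1) (t0 - r1))"
    by (simp add: oct8_def w)
  then show ?thesis by blast
qed

lemma oct8_cases: obtains a b c d e f g h where "w = oct8 a b c d e f g h"
  using oct8_surj[of w] by blast

lemma oct8_eq_iff [simp]:
  "oct8 a b c d e f g h = oct8 a' b' c' d' e' f' g' h' \<longleftrightarrow>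
    a = a' \<and> b = b' \<and> c = c' \<and> d = d' \<and> e = e' \<and> f = f' \<and> g = g' \<and> h = h'"
  unfolding oct8_def complex_eq_iff by (simp add: field_simps) argo

lemma oct8_add: "oct8 a b c d e f g h + oct8 a' b' c' d' e' f' g' h' =
    oct8 (a + a') (b + b') (c + c') (d + d') (e + e') (f + f') (g + g') (h + h')"
  by (simp add: oct8_def field_simps)

lemma oct8_diff: "oct8 a b c d e f g h - oct8 a' b' c' d' e' f' g' h' =
    oct8 (a - a') (b - b') (c - c') (d - d') (e - e') (f - f') (g - g') (h - h')"
  by (simp add: oct8_def field_simps)

lemma oct8_minus: "- oct8 a b c d e f g h = oct8 (-a) (-b) (-c) (-d) (-e) (-f) (-g) (-h)"
  by (simp add: oct8_def field_simps)

lemma oct8_zero: "0 = oct8 0 0 0 0 0 0 0 0"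
  by (simp add: oct8_def zero_prod_def)

lemma oct8_cscale: "cscale z (oct8 a b c d e f g h) =
    oct8 (z * a) (z * b) (z * c) (z * d) (z * e) (z * f) (z * g) (z * h)"
  by (simp add: oct8_def field_simps)

text \<open>Quaternion conjugation is the adjugate of a 2 x 2 matrix, so the product of
  \<open>(M, A)\<close> and \<open>(M', A')\<close> has the halves \<open>M M' - adj(A') A\<close>
  and \<open>A adj(M') + A' M\<close>.\<close>

lemma oct8_cmul: "cmul (oct8 a b c d e f g h) (oct8 a' b' c' d' e' f' g' h') =
    oct8 (a * a' + b * c' - (h' * e - f' * g)) (a * b' + b * d' - (h' * f - f' * h))
         (c * a' + d * c' - (e' * g - g' * e)) (c * b' + d * d' - (e' * h - g' * f))
         (e * d' - f * c' + e' * a + f' * c) (f * a' - e * b' + e' * b + f' * d)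
         (g * d' - h * c' + g' * a + h' * c) (h * a' - g * b' + g' * b + h' * d)"
  unfolding oct8_def
  by (simp only: cbilin.simps omul.simps qmul.simps qcnj.simps diff_Pair add_Pair prod.inject
        plus_complex.sel minus_complex.sel times_complex.sel)
    (intro conjI; simp add: field_simps)

lemma oct8_ccnj: "ccnj (oct8 a b c d e f g h) = oct8 d (-b) (-c) a (-e) (-f) (-g) (-h)"
  by (simp add: oct8_def field_simps)

text \<open>Real quaternions are the matrices with \<open>d = cnj a\<close> and
  \<open>c = - cnj b\<close>. The antilinear map fixing them is the adjoint of the adjugate, not the
  entrywise conjugate.\<close>

lemma oct8_ctau: "ctau (oct8 a b c d e f g h) =
    oct8 (cnj d) (- cnj c) (- cnj b) (cnj a) (cnj h) (- cnj g) (- cnj f) (cnj e)"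
  by (simp add: oct8_def field_simps)

lemma oct8_gamma: "clin ogamma (oct8 a b c d e f g h) = oct8 a b c d (-e) (-f) (-g) (-h)"
  by (simp add: oct8_def field_simps)

lemma oct8_of_scal: "of_scal z = oct8 z 0 0 z 0 0 0 0"
  by (simp add: oct8_def of_scal_def zero_prod_def)

lemma oct8_scal: "scal (oct8 a b c d e f g h) = (a + d) / 2"
  by (simp add: oct8_def complex_eq_iff)

lemmas oct8_simps = oct8_add oct8_diff oct8_minus oct8_cscale oct8_cmul oct8_ccnj oct8_ctau
  oct8_gamma oct8_of_scal oct8_scal

section \<open>The trilinear form of the Jordan algebra\<close>

lemma cmul_add_left: "cmul (x + y) w = cmul x w + cmul y w"
  and cmul_add_right: "cmul w (x + y) = cmul w x + cmul w y"
  and cmul_cscale_left: "cmul (cscale c x) w = cscale c (cmul x w)"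
  by ((cases x rule: oct8_cases, cases y rule: oct8_cases, cases w rule: oct8_cases),
      simp add: oct8_simps algebra_simps)+

lemma cmul_zero [simp]: "cmul 0 w = 0" "cmul w 0 = 0"
  using cmul_add_left[of 0 0 w] cmul_add_right[of w 0 0] by auto

lemma cscale_zero [simp]: "cscale c 0 = (0 :: cayleyC)"
  using cscale.simps[of c 0 "0 :: cayley"] by (simp flip: zero_prod_def)

lemma cscale_simps [simp]:
  "cscale c (x + y) = cscale c x + cscale c y"
  "cscale 1 x = x"
  "cscale c (cscale d x) = cscale (c * d) x"
  for x y :: cayleyC
  by (cases x rule: oct8_cases, cases y rule: oct8_cases, simp add: oct8_simps algebra_simps)+

lemma cscale_diff: "cscale c (x - y) = cscale c x - cscale c y"
  for x y :: cayleyC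
  by (cases x rule: oct8_cases, cases y rule: oct8_cases, simp add: oct8_simps algebra_simps)+

lemma scal_simps [simp]:
  "scal (x + y) = scal x + scal y"
  "scal (x - y) = scal x - scal y"
  "scal (cscale c x) = c * scal x"
  "scal 0 = 0"
  by (cases x rule: oct8_cases, cases y rule: oct8_cases, simp add: oct8_simps oct8_zero field_simps)+

lemma scal_sum: "scal (sum f A) = (\<Sum>i\<in>A. scal (f i))"
  by (induction A rule: infinite_finite_induct) auto

lemma scal_cmul_commute: "scal (cmul x y) = scal (cmul y x)"
  by (cases x rule: oct8_cases, cases y rule: oct8_cases, simp add: oct8_simps algebra_simps)

text \<open>Octonions are not associative, but their associator has no scalar part; this is what
  makes traces of matrix products manageable.\<close>

lemma scal_cmul_assoc: "scal (cmul (cmul x y) w) = scal (cmul x (cmul y w))"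
  by (cases x rule: oct8_cases, cases y rule: oct8_cases, cases w rule: oct8_cases,
      simp add: oct8_simps, simp add: field_simps)

lemma cmul_one: "cmul (of_scal 1) x = x"
  by (cases x rule: oct8_cases, simp add: oct8_simps)

lemma cmul_sum_left: "cmul (sum f A) w = (\<Sum>i\<in>A. cmul (f i) w)"
  and cmul_sum_right: "cmul w (sum f A) = (\<Sum>i\<in>A. cmul w (f i))"
  by (induction A rule: infinite_finite_induct) (auto simp: cmul_add_left cmul_add_right)

lemma cscale_sum: "cscale c (sum f A) = (\<Sum>i\<in>A. cscale c (f i :: cayleyC))"
  by (induction A rule: infinite_finite_induct) auto

lemma mmul_add_left: "mmul (X + Y) Z = mmul X Z + mmul Y Z"
  and mmul_add_right: "mmul Z (X + Y) = mmul Z X + mmul Z Y"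
  by (simp_all add: mmul_def vec_eq_iff cmul_add_left cmul_add_right sum.distrib)

lemma mmul_mscale_left: "mmul (mscale c X) Z = mscale c (mmul X Z)"
  by (simp add: mmul_def mscale_def vec_eq_iff cmul_cscale_left cscale_sum)

lemma mscale_simps [simp]:
  "mscale c (X + Y) = mscale c X + mscale c Y"
  "mscale c (X - Y) = mscale c X - mscale c Y"
  "mscale c (mscale d X) = mscale (c * d) X"
  "mscale 1 X = X"
  by (simp_all add: mscale_def vec_eq_iff cscale_diff)

lemma mmul_one: "mmul mE X = X"
  by (simp add: mmul_def mE_def vec_eq_iff if_distrib[where f = "\<lambda>u. cmul u _"] cmul_one sum.delta cong: if_cong)

lemma jtr_simps [simp]:
  "jtr (X + Y) = jtr X + jtr Y"
  "jtr (X - Y) = jtr X - jtr Y"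
  "jtr (mscale c X) = c * jtr X"
  by (simp_all add: jtr_def scal_sum mscale_def sum.distrib sum_subtractf sum_distrib_left)

lemma jtr_mmul: "jtr (mmul X Y) = (\<Sum>i\<in>UNIV. \<Sum>j\<in>UNIV. scal (cmul (X $ i $ j) (Y $ j $ i)))"
  by (simp add: jtr_def scal_sum mmul_def)

lemma jtr_mmul_commute: "jtr (mmul X Y) = jtr (mmul Y X)"
  unfolding jtr_mmul by (subst sum.swap) (simp add: scal_cmul_commute)

lemma jtr_mmul_assoc: "jtr (mmul (mmul X Y) Z) = jtr (mmul X (mmul Y Z))"
proof -
  have "jtr (mmul (mmul X Y) Z) = (\<Sum>i\<in>UNIV. \<Sum>j\<in>UNIV. \<Sum>k\<in>UNIV. scal (cmul (cmul (X $ i $ k) (Y $ k $ j)) (Z $ j $ i)))"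
    unfolding jtr_mmul by (simp add: mmul_def cmul_sum_left scal_sum)
  also have "\<dots> = (\<Sum>i\<in>UNIV. \<Sum>k\<in>UNIV. \<Sum>j\<in>UNIV. scal (cmul (X $ i $ k) (cmul (Y $ k $ j) (Z $ j $ i))))"
    unfolding scal_cmul_assoc by (rule sum.cong[OF refl], rule sum.swap)
  also have "\<dots> = jtr (mmul X (mmul Y Z))"
    unfolding jtr_mmul by (simp add: mmul_def cmul_sum_right scal_sum)
  finally show ?thesis .
qed

lemma jform_eq: "jform X Y = jtr (mmul X Y)"
  using jtr_mmul_commute[of Y X] by (simp add: jform_def jprod_def)

text \<open>Freudenthal's trilinear form; on the diagonal it is three times the cubic
  determinant.\<close>

definition jtri :: "matC \<Rightarrow> matC \<Rightarrow> matC \<Rightarrow> complex" where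
  "jtri X Y Z = jform (jcross X Y) Z"

lemma jtri_eq: "jtri X Y Z = (jtr (mmul (mmul X Y) Z) + jtr (mmul (mmul Y X) Z) - jtr X * jtr (mmul Y Z)
    - jtr Y * jtr (mmul X Z) - jtr Z * jtr (mmul X Y) + jtr X * jtr Y * jtr Z) / 2"
proof -
  have mm: "mmul (A - B) C = mmul A C - mmul B C" for A B C
    using mmul_add_left[of "A - B" B C] by simp
  show ?thesis
    unfolding jtri_def jcross_def jform_eq jprod_def
    by (simp add: mmul_add_left mm mmul_mscale_left mmul_one field_simps)
qed

lemma jtri_swap12: "jtri X Y Z = jtri Y X Z"
  unfolding jtri_eq by (simp add: jtr_mmul_commute[of X Y] algebra_simps)

lemma jtri_cycle: "jtri X Y Z = jtri Y Z X"
proof -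
  have "jtr (mmul (mmul Y Z) X) = jtr (mmul (mmul X Y) Z)"
    by (metis jtr_mmul_assoc jtr_mmul_commute)
  moreover have "jtr (mmul (mmul Z Y) X) = jtr (mmul (mmul Y X) Z)"
    by (metis jtr_mmul_assoc jtr_mmul_commute)
  ultimately show ?thesis
    unfolding jtri_eq
    using jtr_mmul_commute[of Y X] jtr_mmul_commute[of Z X] by (simp add: algebra_simps)
qed

lemma jtri_add: "jtri (X + Y) Z W = jtri X Z W + jtri Y Z W"
  unfolding jtri_eq by (simp add: mmul_add_left mmul_add_right field_simps)

text \<open>Six times a symmetric trilinear form is a signed sum of its diagonal values at sums of
  the arguments, so an additive map carries invariance of the cubic form over to the trilinear
  one.\<close>

lemma jtri_polarize:
  assumes f: "\<And>X Y. X \<in> S \<Longrightarrow> Y \<in> S \<Longrightarrow> f (X + Y) = f X + f Y"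
    and S: "\<And>X Y. X \<in> S \<Longrightarrow> Y \<in> S \<Longrightarrow> X + Y \<in> S"
    and cub: "\<And>X. X \<in> S \<Longrightarrow> jtri (f X) (f X) (f X) = jtri X X X"
    and XYZ: "X \<in> S" "Y \<in> S" "Z \<in> S"
  shows "jtri (f X) (f Y) (f Z) = jtri X Y Z"
proof -
  have add2: "jtri Z (X + Y) W = jtri Z X W + jtri Z Y W" for X Y Z W
    by (metis jtri_add jtri_swap12)
  have add3: "jtri Z W (X + Y) = jtri Z W X + jtri Z W Y" for X Y Z W
    by (metis jtri_add jtri_cycle)
  have pol: "6 * jtri X Y Z = jtri (X+Y+Z) (X+Y+Z) (X+Y+Z) - jtri (X+Y) (X+Y) (X+Y) - jtri (Y+Z) (Y+Z) (Y+Z)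
      - jtri (X+Z) (X+Z) (X+Z) + jtri X X X + jtri Y Y Y + jtri Z Z Z" for X Y Z
  proof -
    have "jtri X Z Y = jtri X Y Z" "jtri Y X Z = jtri X Y Z" "jtri Y Z X = jtri X Y Z"
      "jtri Z X Y = jtri X Y Z" "jtri Z Y X = jtri X Y Z"
      by (metis jtri_cycle jtri_swap12)+
    then show ?thesis
      by (simp add: jtri_add add2 add3)
  qed
  have "6 * jtri (f X) (f Y) (f Z) = 6 * jtri X Y Z"
    unfolding pol by (simp flip: f add: S XYZ cub)
  then show ?thesis by simp
qed

lemma jherm_eq: "jherm X Y = jtr (mmul (jtau X) Y)"
  by (simp add: jherm_def jform_eq)

lemma jtau_jtau [simp]: "jtau (jtau X) = X"
proof -
  have "ctau (ctau x) = x" for x :: cayleyC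
    by (cases x rule: oct8_cases) (simp add: oct8_simps)
  then show ?thesis by (simp add: jtau_def vec_eq_iff)
qed

lemma jordanC_add: "X \<in> jordanC \<Longrightarrow> Y \<in> jordanC \<Longrightarrow> X + Y \<in> jordanC"
  and jordanC_diff: "X \<in> jordanC \<Longrightarrow> Y \<in> jordanC \<Longrightarrow> X - Y \<in> jordanC"
  and jordanC_mscale: "X \<in> jordanC \<Longrightarrow> mscale c X \<in> jordanC"
  and jordanC_jtau: "X \<in> jordanC \<Longrightarrow> jtau X \<in> jordanC"
  and jordanC_mE: "mE \<in> jordanC"
proof -
  have *: "ccnj (x + y) = ccnj x + ccnj y" "ccnj (x - y) = ccnj x - ccnj y" 
    "ccnj (cscale c x) = cscale c (ccnj x)" "ccnj (ctau x) = ctau (ccnj x)" for x y c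
    by (cases x rule: oct8_cases, cases y rule: oct8_cases, simp add: oct8_simps)+
  have "ccnj 0 = 0" using oct8_ccnj[of 0 0 0 0 0 0 0 0] by (simp add: oct8_zero)
  with * show "X \<in> jordanC \<Longrightarrow> Y \<in> jordanC \<Longrightarrow> X + Y \<in> jordanC"
    "X \<in> jordanC \<Longrightarrow> Y \<in> jordanC \<Longrightarrow> X - Y \<in> jordanC"
    "X \<in> jordanC \<Longrightarrow> mscale c X \<in> jordanC" "X \<in> jordanC \<Longrightarrow> jtau X \<in> jordanC"
    "mE \<in> jordanC"
    by (simp_all add: jordanC_def mstar_def vec_eq_iff mscale_def jtau_def mE_def)
qed

lemma jordanC_jprod:
  assumes "X \<in> jordanC" "Y \<in> jordanC"
  shows "jprod X Y \<in> jordanC"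
proof -
  have add: "ccnj (x + y) = ccnj x + ccnj y" for x y
    by (cases x rule: oct8_cases, cases y rule: oct8_cases, simp add: oct8_simps)
  have z: "ccnj 0 = 0" using oct8_ccnj[of 0 0 0 0 0 0 0 0] by (simp add: oct8_zero)
  have mul: "ccnj (cmul x y) = cmul (ccnj y) (ccnj x)" for x y
    by (cases x rule: oct8_cases, cases y rule: oct8_cases, simp add: oct8_simps algebra_simps)
  have sum: "ccnj (sum f A) = (\<Sum>i\<in>A. ccnj (f i))" for f and A :: "3 set"
    by (induction A rule: infinite_finite_induct) (auto simp: z add)
  have XY: "ccnj (X $ j $ i) = X $ i $ j" "ccnj (Y $ j $ i) = Y $ i $ j" for i j
    using assms by (simp_all add: jordanC_def mstar_def vec_eq_iff)
  have "mmul X Y + mmul Y X \<in> jordanC"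
    by (simp add: jordanC_def mstar_def vec_eq_iff mmul_def sum add mul XY add.commute)
  then show ?thesis unfolding jprod_def by (rule jordanC_mscale)
qed

lemma jordanC_jcross: "X \<in> jordanC \<Longrightarrow> Y \<in> jordanC \<Longrightarrow> jcross X Y \<in> jordanC"
  unfolding jcross_def
  by (intro jordanC_mscale jordanC_add jordanC_diff jordanC_jprod jordanC_mE)

section \<open>The Jordan algebra in skew-matrix coordinates\<close>

text \<open>The skew matrix of size 6 is \<open>(t eps2, x; -x\<^sup>T, w)\<close> and the \<open>e\<^sub>4\<close>-part is \<open>(y, z)\<close>. Only the entries
  of \<open>w\<close> above the diagonal are read.\<close>

definition jcoords :: "complex \<Rightarrow> complex^4^4 \<Rightarrow> complex^4^2 \<Rightarrow> complex^2^2 \<Rightarrow> complex^4^2 \<Rightarrow> matC" where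
  "jcoords t w x y z = jmat t (w$1$2) (w$3$4)
    (oct8 (w$1$4) (- w$1$3) (w$2$4) (- w$2$3) (y$1$1) (y$1$2) (y$2$1) (y$2$2))
    (oct8 (- x$2$3) (x$1$3) (- x$2$4) (x$1$4) (z$1$1) (z$1$2) (z$2$1) (z$2$2))
    (oct8 (x$1$2) (- x$1$1) (x$2$2) (- x$2$1) (z$1$3) (z$1$4) (z$2$3) (z$2$4))"

definition skew :: "'a::ab_group_add^'n^'n \<Rightarrow> bool" where
  "skew w \<longleftrightarrow> (\<forall>i j. w $ i $ j = - w $ j $ i)"

definition mip :: "complex^'n^'m \<Rightarrow> complex^'n^'m \<Rightarrow> complex" where
  "mip A B = (\<Sum>i\<in>UNIV. \<Sum>j\<in>UNIV. cnj (A $ i $ j) * B $ i $ j)"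

lemma jmat_nth [simp]:
  "jmat t1 t2 t3 x1 x2 x3 $ 1 $ 1 = of_scal t1"
  "jmat t1 t2 t3 x1 x2 x3 $ 1 $ 2 = x3"
  "jmat t1 t2 t3 x1 x2 x3 $ 1 $ 3 = ccnj x2"
  "jmat t1 t2 t3 x1 x2 x3 $ 2 $ 1 = ccnj x3"
  "jmat t1 t2 t3 x1 x2 x3 $ 2 $ 2 = of_scal t2"
  "jmat t1 t2 t3 x1 x2 x3 $ 2 $ 3 = x1"
  "jmat t1 t2 t3 x1 x2 x3 $ 3 $ 1 = x2"
  "jmat t1 t2 t3 x1 x2 x3 $ 3 $ 2 = ccnj x1"
  "jmat t1 t2 t3 x1 x2 x3 $ 3 $ 3 = of_scal t3"
  by (simp_all add: jmat_def)

lemma jmat_eq_iff: "jmat t1 t2 t3 x1 x2 x3 = jmat t1' t2' t3' x1' x2' x3' \<longleftrightarrow>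
    t1 = t1' \<and> t2 = t2' \<and> t3 = t3' \<and> x1 = x1' \<and> x2 = x2' \<and> x3 = x3'" (is "?l = ?r")
proof
  assume l: ?l
  have "of_scal t1 = of_scal t1'" "of_scal t2 = of_scal t2'" "of_scal t3 = of_scal t3'" 
    "x1 = x1'" "x2 = x2'" "x3 = x3'"
    using arg_cong[OF l, of "\<lambda>X. X$1$1"] arg_cong[OF l, of "\<lambda>X. X$2$2"] arg_cong[OF l, of "\<lambda>X. X$3$3"]
      arg_cong[OF l, of "\<lambda>X. X$2$3"] arg_cong[OF l, of "\<lambda>X. X$3$1"] arg_cong[OF l, of "\<lambda>X. X$1$2"] by simp_all
  then show ?r by (simp add: oct8_of_scal)
qed simp

text \<open>In a real vector space \<open>a = - a\<close> forces \<open>a = 0\<close>, which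
  accounts for the zero diagonal.\<close>

lemma skew_iffs:
  fixes w :: "'a::real_vector^4^4"
  shows "skew w \<longleftrightarrow> w$1$1 = 0 \<and> w$2$2 = 0 \<and> w$3$3 = 0 \<and> w$4$4 = 0 \<and> w$2$1 = - w$1$2 \<and> w$3$1 = - w$1$3
    \<and> w$4$1 = - w$1$4 \<and> w$3$2 = - w$2$3 \<and> w$4$2 = - w$2$4 \<and> w$4$3 = - w$3$4"
  unfolding skew_def forall_4 eq_neg_iff_add_eq_0 
  by (auto simp: add.commute simp flip: scaleR_2 eq_neg_iff_add_eq_0)

lemma jcoords_in_jordanC [simp]: "jcoords t w x y z \<in> jordanC"
  by (simp add: jcoords_def jmat_in_jordanC)

lemma jcoords_inj:
  assumes "skew w" "skew w'"
  shows "jcoords t w x y z = jcoords t' w' x' y' z' \<longleftrightarrow> t = t' \<and> w = w' \<and> x = x' \<and> y = y' \<and> z = z'"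
  using assms unfolding jcoords_def jmat_eq_iff skew_iffs
  by (simp add: vec_eq_iff forall_2 forall_4) auto

lemma jordanC_cases:
  assumes "X \<in> jordanC"
  obtains t w x y z where "skew w" "X = jcoords t w x y z"
proof -
  obtain a1 b1 c1 d1 e1 f1 g1 h1 where 1: "X$2$3 = oct8 a1 b1 c1 d1 e1 f1 g1 h1" by (rule oct8_cases)
  obtain a2 b2 c2 d2 e2 f2 g2 h2 where 2: "X$3$1 = oct8 a2 b2 c2 d2 e2 f2 g2 h2" by (rule oct8_cases)
  obtain a3 b3 c3 d3 e3 f3 g3 h3 where 3: "X$1$2 = oct8 a3 b3 c3 d3 e3 f3 g3 h3" by (rule oct8_cases)
  \<comment> \<open>\<open>u\<close> holds the entries above the diagonal with the signs that invert
    \<open>jcoords\<close>; subtracting its transpose makes \<open>w\<close> skew by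
    construction.\<close>
  define w :: "complex^4^4" where "w = (\<chi> i j. let u = (\<lambda>i j.
     if i = 1 \<and> j = 2 then scal (X$2$2) else if i = 3 \<and> j = 4 then scal (X$3$3)
     else if i = 1 \<and> j = 3 then - b1 else if i = 1 \<and> j = 4 then a1
     else if i = 2 \<and> j = 3 then - d1 else if i = 2 \<and> j = 4 then c1 else 0) in u i j - u j i)"
  define x :: "complex^4^2" where "x = (\<chi> i j. if i = 1 then 
     (if j = 1 then - b3 else if j = 2 then a3 else if j = 3 then b2 else d2) else
     (if j = 1 then - d3 else if j = 2 then c3 else if j = 3 then - a2 else - c2))"
  define y :: "complex^2^2" where "y = vector [vector [e1, f1], vector [g1, h1]]"
  define z :: "complex^4^2" where "z = (\<chi> i j. if i = 1 then 
     (if j = 1 then e2 else if j = 2 then f2 else if j = 3 then e3 else f3) else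
     (if j = 1 then g2 else if j = 2 then h2 else if j = 3 then g3 else h3))"
  have "skew w" by (simp add: skew_def w_def Let_def)
  moreover have "X = jcoords (scal (X$1$1)) w x y z"
    by (subst jordanC_jmat[OF assms, symmetric]) (simp add: jcoords_def 1 2 3 w_def x_def y_def z_def)
  ultimately show ?thesis by (rule that)
qed

lemma jcoords_add: "jcoords t w x y z + jcoords t' w' x' y' z' = jcoords (t + t') (w + w') (x + x') (y + y') (z + z')"
  by (simp add: jcoords_def vec_eq_iff forall_3 oct8_simps)

text \<open>Complex scalars act on matrices as left factors \<open>mat c\<close>, which keeps
  scaling inside matrix multiplication; this rule evaluates it entrywise.\<close>

lemma mat_mul_nth [simp]: "(mat c ** A) $ i $ j = c * A $ i $ j"
  by (simp add: matrix_matrix_mult_def mat_def if_distrib[where f = "\<lambda>u. u * _"] cong: if_cong)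

lemma mscale_jcoords: "mscale c (jcoords t w x y z) = jcoords (c * t) (mat c ** w) (mat c ** x) (mat c ** y) (mat c ** z)"
  by (simp add: jcoords_def vec_eq_iff forall_3 oct8_simps mscale_def)

lemma jsigma_jcoords: "jsigma (jcoords t w x y z) = jcoords t w (- x) y (- z)"
  by (simp add: jcoords_def jsigma_def vec_eq_iff forall_3 oct8_simps)

lemma jgamma_jcoords: "jgamma (jcoords t w x y z) = jcoords t w x (- y) (- z)"
  by (simp add: jcoords_def jgamma_def vec_eq_iff forall_3 oct8_simps)

text \<open>The half is needed because \<open>mip\<close> counts each entry above the diagonal of a
  skew matrix twice.\<close>

lemma jherm_jcoords:
  assumes "skew w" "skew w'"
  shows "jherm (jcoords t w x y z) (jcoords t' w' x' y' z') = cnj t * t' + mip w w' / 2 + mip x x' + mip y y' + mip z z'"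
  using assms unfolding jherm_eq jtr_mmul skew_iffs sum_3
  by (simp add: jcoords_def jtau_def oct8_simps mip_def sum_2 sum_4) (simp add: field_simps)

text \<open>The Pfaffian of a skew matrix of size 4; the next definition is its
  polarization.\<close>

definition pf4 :: "complex^4^4 \<Rightarrow> complex" where
  "pf4 w = w$1$2 * w$3$4 - w$1$3 * w$2$4 + w$1$4 * w$2$3"

definition pf4_polar :: "complex^4^4 \<Rightarrow> complex^4^4 \<Rightarrow> complex" where
  "pf4_polar w u = w$1$2 * u$3$4 + w$3$4 * u$1$2 - w$1$3 * u$2$4 - w$2$4 * u$1$3 + w$1$4 * u$2$3 + w$2$3 * u$1$4"

definition eps2 :: "complex^2^2" where
  "eps2 = vector [vector [0, 1], vector [-1, 0]]"

text \<open>The coefficient in \<open>M - transpose M = mat (alt M) ** eps2\<close>.\<close>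

definition alt :: "complex^2^2 \<Rightarrow> complex" where
  "alt M = M$1$2 - M$2$1"

text \<open>The determinant in blocks. The first two terms are the Pfaffian of the skew matrix of
  size 6; the others are minus the (1,2) entry of its product with the \<open>e\<^sub>4\<close>-part
  \<open>(y, z)\<close> on the left and the transpose on the right. The last term is halved because
  \<open>z ** w ** transpose z\<close> is itself skew.\<close>

definition jcub :: "complex \<Rightarrow> complex^4^4 \<Rightarrow> complex^4^2 \<Rightarrow> complex^2^2 \<Rightarrow> complex^4^2 \<Rightarrow> complex" where
  "jcub t w x y z = t * pf4 w - pf4_polar w (transpose x ** eps2 ** x) - t * det y - alt (y ** x ** transpose z)
     - alt (z ** w ** transpose z) / 2"

lemma jtri_jcoords:
  assumes "skew w"
  shows "jtri (jcoords t w x y z) (jcoords t w x y z) (jcoords t w x y z) = 3 * jcub t w x y z"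
  using assms unfolding jtri_eq jtr_mmul_assoc unfolding jtr_mmul sum_3 skew_iffs
  by (simp add: jcoords_def oct8_simps mmul_def sum_3 jtr_def,
      simp add: jcub_def pf4_def pf4_polar_def eps2_def alt_def det_2 matrix_matrix_mult_def transpose_def sum_2 sum_4,
      simp add: field_simps)

section \<open>Determinants, Pfaffians and unitary matrices\<close>

lemma sum_UNIV_sum: "(\<Sum>k\<in>(UNIV :: ('a::finite + 'b::finite) set). f k) = (\<Sum>i\<in>UNIV. f (Inl i)) + (\<Sum>j\<in>UNIV. f (Inr j))"
  unfolding UNIV_Plus_UNIV[symmetric] by (simp only: sum.Plus finite comp_def)

lemma prod_UNIV_sum: "(\<Prod>k\<in>(UNIV :: ('a::finite + 'b::finite) set). f k) = (\<Prod>i\<in>UNIV. f (Inl i)) * (\<Prod>j\<in>UNIV. f (Inr j))"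
  unfolding UNIV_Plus_UNIV[symmetric] by (simp only: prod.Plus finite comp_def)

text \<open>A block permutation is a permutation of the left summand composed with one of the right
  summand, and embedding into a larger set does not change a sign.\<close>

lemma sign_map_sum:
  fixes q :: "'a::finite \<Rightarrow> 'a" and r :: "'b::finite \<Rightarrow> 'b"
  assumes "q permutes UNIV" "r permutes UNIV"
  shows "map_sum q r permutes UNIV" "sign (map_sum q r) = sign q * sign r"
proof -
  have l: "map_permutation UNIV Inl q = map_sum q (id :: 'b \<Rightarrow> 'b)"
    by (rule ext, rename_tac u, case_tac u) (auto simp: map_permutation_def restrict_id_def)
  have r: "map_permutation UNIV Inr r = map_sum (id :: 'a \<Rightarrow> 'a) r"
    by (rule ext, rename_tac u, case_tac u) (auto simp: map_permutation_def restrict_id_def)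
  have c: "map_sum q r = map_sum q id \<circ> map_sum id r"
    by (simp add: map_sum.comp)
  have pl: "map_sum q (id :: 'b \<Rightarrow> 'b) permutes UNIV" "map_sum (id :: 'a \<Rightarrow> 'a) r permutes UNIV"
    unfolding l[symmetric] r[symmetric] using assms
    by (auto intro!: permutes_subset[OF map_permutation_permutes] simp: bij_betw_def)
  then show "map_sum q r permutes UNIV"
    unfolding c by (rule permutes_compose[rotated])
  have "sign (map_sum q r) = sign (map_sum q (id :: 'b \<Rightarrow> 'b)) * sign (map_sum (id :: 'a \<Rightarrow> 'a) r)"
    unfolding c using pl by (intro sign_compose) (auto intro: permutes_imp_permutation[of UNIV])
  then show "sign (map_sum q r) = sign q * sign r"
    unfolding l[symmetric] r[symmetric] using assms by (simp add: sign_map_permutation)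
qed

definition blkl :: "'c^('a::finite + 'b::finite)^('a + 'b) \<Rightarrow> 'c^'a^'a" where
  "blkl A = (\<chi> i j. A $ Inl i $ Inl j)"

definition blkr :: "'c^('a::finite + 'b::finite)^('a + 'b) \<Rightarrow> 'c^'b^'b" where
  "blkr A = (\<chi> i j. A $ Inr i $ Inr j)"

text \<open>In the Leibniz sum only permutations that map the left summand into itself survive. By
  finiteness they map it onto itself, hence preserve the right summand too, and are exactly the
  \<open>map_sum q r\<close>.\<close>

lemma det_block_triangular:
  fixes A :: "'c::comm_ring_1^('a::finite + 'b::finite)^('a + 'b)"
  assumes "\<And>i j. A $ Inl i $ Inr j = 0"
  shows "det A = det (blkl A) * det (blkr A)"
proof -
  let ?P = "{p :: 'a + 'b \<Rightarrow> 'a + 'b. p permutes UNIV}"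
  let ?Q = "{p :: 'a + 'b \<Rightarrow> 'a + 'b. p permutes UNIV \<and> p ` range Inl \<subseteq> range Inl}"
  let ?L = "{q :: 'a \<Rightarrow> 'a. q permutes UNIV}" and ?R = "{r :: 'b \<Rightarrow> 'b. r permutes UNIV}"
  let ?t = "\<lambda>p. of_int (sign p) * (\<Prod>k\<in>UNIV. A $ k $ p k)"
  have "det A = (\<Sum>p\<in>?P. ?t p)" by (simp add: det_def)
  also have "\<dots> = (\<Sum>p\<in>?Q. ?t p)"
  proof (rule sum.mono_neutral_right)
    show "\<forall>p\<in>?P - ?Q. ?t p = 0"
    proof
      fix p assume "p \<in> ?P - ?Q"
      then obtain i where "p (Inl i) \<notin> range Inl" by blast
      then obtain j where "p (Inl i) = Inr j" by (cases "p (Inl i)") auto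
      then have "A $ Inl i $ p (Inl i) = 0" using assms by simp
      then have "(\<Prod>k\<in>UNIV. A $ k $ p k) = 0" by (meson UNIV_I finite prod_zero)
      then show "?t p = 0" by simp
    qed
  qed (auto simp: finite_permutations)
  also have "\<dots> = (\<Sum>(q, r)\<in>?L \<times> ?R. (of_int (sign q) * (\<Prod>k\<in>UNIV. blkl A $ k $ q k)) * 
      (of_int (sign r) * (\<Prod>k\<in>UNIV. blkr A $ k $ r k)))"
  proof (rule sum.reindex_bij_witness[where
      j = "\<lambda>p. (\<lambda>a. projl (p (Inl a)), \<lambda>b. projr (p (Inr b)))" and i = "\<lambda>(q, r). map_sum q r"])
    fix p assume "p \<in> ?Q"
    then have p: "p permutes UNIV" "p ` range Inl \<subseteq> range Inl" by auto
    then have inj: "inj p" by (simp add: permutes_inj)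
    have "p ` range Inl = range Inl"
      using p(2) inj by (intro endo_inj_surj) (auto intro: inj_on_subset)
    have l: "p (Inl a) = Inl (projl (p (Inl a)))" for a
    proof -
      have "p (Inl a) \<in> range Inl" using p(2) by blast
      then show ?thesis by auto
    qed
    have r: "p (Inr b) = Inr (projr (p (Inr b)))" for b
    proof (cases "p (Inr b)")
      case (Inl a)
      then have "p (Inr b) \<in> p ` range Inl" using \<open>p ` range Inl = range Inl\<close> by auto
      then show ?thesis using inj by (auto dest: injD)
    qed simp
    show *: "(case (\<lambda>a. projl (p (Inl a)), \<lambda>b. projr (p (Inr b))) of (q, r) \<Rightarrow> map_sum q r) = p"
      by (rule ext, rename_tac u, case_tac u) (use l r in auto)
    have "inj (\<lambda>a. projl (p (Inl a)))"
      by (rule injI) (metis l inj injD sum.inject(1))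
    moreover have "inj (\<lambda>b. projr (p (Inr b)))"
      by (rule injI) (metis r inj injD sum.inject(2))
    ultimately have lr: "(\<lambda>a. projl (p (Inl a))) permutes UNIV" "(\<lambda>b. projr (p (Inr b))) permutes UNIV"
      by (auto intro!: bij_imp_permutes simp: bij_def finite_UNIV_inj_surj)
    then show "(\<lambda>a. projl (p (Inl a)), \<lambda>b. projr (p (Inr b))) \<in> ?L \<times> ?R" by simp
    have "sign p = sign (\<lambda>a. projl (p (Inl a))) * sign (\<lambda>b. projr (p (Inr b)))"
      using sign_map_sum(2)[OF lr] * by simp
    moreover have "(\<Prod>k\<in>UNIV. A $ k $ p k) = (\<Prod>k\<in>UNIV. blkl A $ k $ projl (p (Inl k))) * (\<Prod>k\<in>UNIV. blkr A $ k $ projr (p (Inr k)))"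
      unfolding prod_UNIV_sum by (simp add: blkl_def blkr_def flip: l r)
    ultimately show "(case (\<lambda>a. projl (p (Inl a)), \<lambda>b. projr (p (Inr b))) of (q, r) \<Rightarrow>
        (of_int (sign q) * (\<Prod>k\<in>UNIV. blkl A $ k $ q k)) * (of_int (sign r) * (\<Prod>k\<in>UNIV. blkr A $ k $ r k))) = ?t p"
      by (simp add: mult_ac)
  next
    fix u assume "u \<in> ?L \<times> ?R"
    then show "(case u of (q, r) \<Rightarrow> map_sum q r) \<in> ?Q"
      using sign_map_sum(1) by fastforce
  qed auto
  also have "\<dots> = det (blkl A) * det (blkr A)"
    by (simp add: det_def sum_product sum.cartesian_product)
  finally show ?thesis .
qed

lemma det_4:
  "det (A::'a::comm_ring_1^4^4) =
    A$1$1 * (A$2$2 * (A$3$3 * A$4$4 - A$3$4 * A$4$3) - A$2$3 * (A$3$2 * A$4$4 - A$3$4 * A$4$2) + A$2$4 * (A$3$2 * A$4$3 - A$3$3 * A$4$2))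
  - A$1$2 * (A$2$1 * (A$3$3 * A$4$4 - A$3$4 * A$4$3) - A$2$3 * (A$3$1 * A$4$4 - A$3$4 * A$4$1) + A$2$4 * (A$3$1 * A$4$3 - A$3$3 * A$4$1))
  + A$1$3 * (A$2$1 * (A$3$2 * A$4$4 - A$3$4 * A$4$2) - A$2$2 * (A$3$1 * A$4$4 - A$3$4 * A$4$1) + A$2$4 * (A$3$1 * A$4$2 - A$3$2 * A$4$1))
  - A$1$4 * (A$2$1 * (A$3$2 * A$4$3 - A$3$3 * A$4$2) - A$2$2 * (A$3$1 * A$4$3 - A$3$3 * A$4$1) + A$2$3 * (A$3$1 * A$4$2 - A$3$2 * A$4$1))"
proof -
  have f1: "finite {2::4, 3, 4}" "1 \<notin> {2::4, 3, 4}"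
    and f2: "finite {3::4, 4}" "2 \<notin> {3::4, 4}"
    and f3: "finite {4::4}" "3 \<notin> {4::4}"
    by auto
  show ?thesis
    unfolding det_def UNIV_4
    unfolding sum_over_permutations_insert[OF f1]
    unfolding sum_over_permutations_insert[OF f2]
    unfolding sum_over_permutations_insert[OF f3]
    unfolding permutes_sing
    by (simp add: sign_swap_id permutation_swap_id permutation_compose sign_compose sign_id swap_id_eq algebra_simps)
qed


section \<open>Congruence of skew matrices\<close>

lemma pf4_congr:
  assumes "skew w"
  shows "pf4 (C ** w ** transpose C) = det C * pf4 w"
proof -
  \<comment> \<open>Each entry is a combination of the 2 x 2 minors of rows \<open>i\<close> and
    \<open>j\<close> of \<open>C\<close>. Once only the six independent entries of \<open>w\<close>
    remain, the claim is a polynomial identity.\<close>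
  have e: "(C ** w ** transpose C) $ i $ j = (C$i$1 * C$j$2 - C$i$2 * C$j$1) * w$1$2
     + (C$i$1 * C$j$3 - C$i$3 * C$j$1) * w$1$3 + (C$i$1 * C$j$4 - C$i$4 * C$j$1) * w$1$4
     + (C$i$2 * C$j$3 - C$i$3 * C$j$2) * w$2$3 + (C$i$2 * C$j$4 - C$i$4 * C$j$2) * w$2$4
     + (C$i$3 * C$j$4 - C$i$4 * C$j$3) * w$3$4" for i j
    using assms unfolding skew_iffs
    by (simp add: matrix_matrix_mult_def transpose_def sum_4) (simp add: algebra_simps)
  show ?thesis
    unfolding pf4_def e det_4 by algebra
qed


lemma pf4_polar_pf4: "pf4_polar w u = pf4 (w + u) - pf4 w - pf4 u"
  by (simp add: pf4_polar_def pf4_def algebra_simps)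

lemma skewD: "skew w \<Longrightarrow> w $ i $ j = - w $ j $ i"
  unfolding skew_def by blast

lemma skew_add:
  assumes "skew w" "skew u"
  shows "skew (w + u)"
  unfolding skew_def
proof (intro allI)
  fix i j
  show "(w + u) $ i $ j = - (w + u) $ j $ i"
    using skewD[OF assms(1), of i j] skewD[OF assms(2), of i j] by simp
qed

lemma skew_iff_transpose: "skew w \<longleftrightarrow> transpose w = - w"
  unfolding skew_def vec_eq_iff transpose_def vec_lambda_beta vector_uminus_component by blast

lemma skew_congr:
  fixes w :: "'a::comm_ring_1^'n^'n" and C :: "'a^'n^'m"
  assumes "skew w"
  shows "skew (C ** w ** transpose C)"
proof -
  have "transpose w = - w"
    using assms by (simp only: skew_iff_transpose)
  then have "transpose (C ** w ** transpose C) = - (C ** w ** transpose C)"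
    by (simp add: matrix_transpose_mul transpose_transpose matrix_mul_assoc)
      (simp add: matrix_matrix_mult_def vec_eq_iff sum_negf)
  then show ?thesis by (simp only: skew_iff_transpose)
qed

lemma matrix_add_rdistrib: "(A + B) ** C = A ** C + B ** (C :: 'a::comm_ring_1^'n^'m)"
  by (simp add: matrix_matrix_mult_def vec_eq_iff sum.distrib algebra_simps)

lemma pf4_polar_congr:
  assumes "skew w" "skew u"
  shows "pf4_polar (C ** w ** transpose C) (C ** u ** transpose C) = det C * pf4_polar w u"
proof -
  have "C ** w ** transpose C + C ** u ** transpose C = C ** (w + u) ** transpose C"
    by (simp add: matrix_add_ldistrib matrix_add_rdistrib)
  then show ?thesis
    by (simp add: pf4_polar_pf4 pf4_congr assms skew_add algebra_simps)
qed

lemma pf4_polar_scale [simp]: "pf4_polar w (mat c ** u) = c * pf4_polar w u" "pf4_polar (mat c ** w) u = c * pf4_polar w u"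
  by (simp_all add: pf4_polar_def algebra_simps)

lemma pf4_scale [simp]: "pf4 (mat c ** w) = c\<^sup>2 * pf4 w"
  by (simp add: pf4_def power2_eq_square algebra_simps)

lemma skew_mat_mul: "skew w \<Longrightarrow> skew (mat c ** w :: complex^'n^'n)"
  unfolding skew_def mat_mul_nth by (metis mult_minus_right)

lemma skew_eps2: "skew eps2"
  by (simp add: skew_def eps2_def forall_2)

lemma skew_eps2_congr: "skew (transpose x ** eps2 ** x)"
  using skew_congr[OF skew_eps2, of "transpose x"] by (simp add: transpose_transpose)

text \<open>Skew matrices of size 2 form a line, so congruence acts on them by a scalar, the
  determinant.\<close>

lemma eps2_congr: "transpose B ** eps2 ** B = mat (det B) ** eps2"
  by (simp add: vec_eq_iff forall_2 matrix_matrix_mult_def[where 'n = 2] eps2_def transpose_def det_2 sum_2 mat_def algebra_simps)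

lemma alt_congr: "alt (P ** M ** transpose P) = det P * alt M"
  by (simp add: alt_def matrix_matrix_mult_def transpose_def sum_2 det_2 algebra_simps)

lemma mat_mul_commute: "A ** mat c = mat c ** (A :: complex^'n^'m)"
  by (simp add: vec_eq_iff) (simp add: matrix_matrix_mult_def mat_def mult.commute if_distrib[where f = "\<lambda>u. _ * u"] cong: if_cong)

lemma transpose_eps2_congr:
  "transpose (B ** x ** transpose C) ** eps2 ** (B ** x ** transpose C)
     = mat (det B) ** (C ** (transpose x ** eps2 ** x) ** transpose C)"
proof -
  have "transpose (B ** x ** transpose C) ** eps2 ** (B ** x ** transpose C)
    = C ** transpose x ** (transpose B ** eps2 ** B) ** x ** transpose C"
    by (simp add: matrix_transpose_mul transpose_transpose matrix_mul_assoc)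
  also have "\<dots> = C ** transpose x ** mat (det B) ** eps2 ** x ** transpose C"
    by (simp add: eps2_congr matrix_mul_assoc)
  also have "C ** transpose x ** mat (det B) = mat (det B) ** (C ** transpose x)"
    by (rule mat_mul_commute)
  finally show ?thesis by (simp add: matrix_mul_assoc)
qed

section \<open>Unitary matrices and the Frobenius inner product\<close>

lemma adjoint_mat_nth [simp]: "adjoint_mat A $ i $ j = cnj (A $ j $ i)"
  by (simp add: adjoint_mat_def)

lemma adjoint_mat_mul: "adjoint_mat (A ** B) = adjoint_mat B ** adjoint_mat A"
  by (simp add: vec_eq_iff matrix_matrix_mult_def mult.commute)

lemma adjoint_mat_adjoint [simp]: "adjoint_mat (adjoint_mat A) = A"
  by (simp add: vec_eq_iff)

lemma adjoint_mat_mat [simp]: "adjoint_mat (mat c) = mat (cnj c)"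
  by (simp add: vec_eq_iff mat_def)

lemma adjoint_mat_transpose: "adjoint_mat (transpose A) = transpose (adjoint_mat A)"
  by (simp add: vec_eq_iff transpose_def)

lemma det_adjoint_mat: "det (adjoint_mat A) = cnj (det A)"
proof -
  have "det (adjoint_mat A) = det (transpose (adjoint_mat A))" by (simp add: det_transpose)
  also have "\<dots> = cnj (det A)" by (simp add: det_def transpose_def)
  finally show ?thesis .
qed

definition unitary :: "complex^'n^'n \<Rightarrow> bool" where
  "unitary A \<longleftrightarrow> adjoint_mat A ** A = mat 1"

lemma unitary_right: "unitary A \<Longrightarrow> A ** adjoint_mat A = mat 1"
  by (simp add: unitary_def matrix_left_right_inverse)

lemma unitary_adjoint: "unitary A \<Longrightarrow> unitary (adjoint_mat A)"
  using unitary_right by (simp add: unitary_def)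

lemma unitary_mul: "unitary A \<Longrightarrow> unitary B \<Longrightarrow> unitary (A ** B)"
  unfolding unitary_def adjoint_mat_mul
  by (metis matrix_mul_assoc matrix_mul_rid)

lemma unitary_transpose: "unitary A \<Longrightarrow> unitary (transpose A)"
  using unitary_right[of A]
  by (simp add: unitary_def adjoint_mat_transpose flip: matrix_transpose_mul)

lemma unitary_det: "unitary A \<Longrightarrow> cnj (det A) * det A = 1"
  unfolding unitary_def by (metis det_I det_adjoint_mat det_mul)

lemma mip_mul_left: "mip (U ** A) B = mip A (adjoint_mat U ** B)"
proof -
  have "mip (U ** A) B = (\<Sum>i\<in>UNIV. \<Sum>j\<in>UNIV. \<Sum>k\<in>UNIV. cnj (U $ i $ k) * cnj (A $ k $ j) * B $ i $ j)"
    by (simp add: mip_def matrix_matrix_mult_def sum_distrib_right)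
  also have "\<dots> = (\<Sum>i\<in>UNIV. \<Sum>k\<in>UNIV. \<Sum>j\<in>UNIV. cnj (U $ i $ k) * cnj (A $ k $ j) * B $ i $ j)"
    by (rule sum.cong[OF refl], rule sum.swap)
  also have "\<dots> = (\<Sum>k\<in>UNIV. \<Sum>i\<in>UNIV. \<Sum>j\<in>UNIV. cnj (U $ i $ k) * cnj (A $ k $ j) * B $ i $ j)"
    by (rule sum.swap)
  also have "\<dots> = (\<Sum>k\<in>UNIV. \<Sum>j\<in>UNIV. \<Sum>i\<in>UNIV. cnj (U $ i $ k) * cnj (A $ k $ j) * B $ i $ j)"
    by (rule sum.cong[OF refl], rule sum.swap)
  also have "\<dots> = mip A (adjoint_mat U ** B)"
    by (simp add: mip_def matrix_matrix_mult_def sum_distrib_left mult_ac)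
  finally show ?thesis .
qed

lemma mip_transpose: "mip (transpose A) (transpose B) = mip A B"
  unfolding mip_def transpose_def by (subst sum.swap) simp

lemma mip_mul_right: "mip (A ** V) B = mip A (B ** adjoint_mat V)"
proof -
  have "mip (A ** V) B = mip (transpose V ** transpose A) (transpose B)"
    by (simp add: mip_transpose flip: matrix_transpose_mul)
  also have "\<dots> = mip (transpose A) (transpose (B ** adjoint_mat V))"
    by (simp add: mip_mul_left adjoint_mat_transpose matrix_transpose_mul)
  finally show ?thesis by (simp add: mip_transpose)
qed

lemma mip_unitary:
  assumes "unitary U" "unitary V"
  shows "mip (U ** A ** V) (U ** B ** V) = mip A B"
  using assms unitary_right[of V] unfolding unitary_def
  by (simp add: mip_mul_right mip_mul_left flip: matrix_mul_assoc) (simp add: matrix_mul_assoc)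

text \<open>Each term picks up a scalar: the two Pfaffian terms \<open>det B * det C\<close>, the
  term \<open>t * det y\<close> the factor \<open>det B * cnj (det B) * det P\<close>, and the two
  \<open>alt\<close> terms \<open>det P\<close>. All of these are 1.\<close>

lemma jcub_act:
  assumes B: "unitary B" and C: "unitary C" and BC: "det B * det C = 1" and P: "det P = 1" and w: "skew w"
  shows "jcub (det B * t) (C ** w ** transpose C) (B ** x ** transpose C) (P ** y ** adjoint_mat B) (P ** z ** adjoint_mat C)
    = jcub t w x y z"
proof -
  have B1: "adjoint_mat B ** B = mat 1" and C1: "adjoint_mat C ** C = mat 1" using B C by (auto simp: unitary_def)
  have C2: "transpose C ** transpose (adjoint_mat C) = mat 1"
    by (metis C1 matrix_transpose_mul transpose_mat)
  have 2: "(P ** y ** adjoint_mat B) ** (B ** x ** transpose C) ** transpose (P ** z ** adjoint_mat C)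
     = P ** (y ** x ** transpose z) ** transpose P"
  proof -
    have "(P ** y ** adjoint_mat B) ** (B ** x ** transpose C) ** transpose (P ** z ** adjoint_mat C)
      = P ** y ** (adjoint_mat B ** B) ** x ** (transpose C ** transpose (adjoint_mat C)) ** transpose z ** transpose P"
      by (simp add: matrix_transpose_mul matrix_mul_assoc)
    then show ?thesis by (simp add: B1 C2 matrix_mul_assoc)
  qed
  have 3: "(P ** z ** adjoint_mat C) ** (C ** w ** transpose C) ** transpose (P ** z ** adjoint_mat C)
     = P ** (z ** w ** transpose z) ** transpose P"
  proof -
    have "(P ** z ** adjoint_mat C) ** (C ** w ** transpose C) ** transpose (P ** z ** adjoint_mat C)
      = P ** z ** (adjoint_mat C ** C) ** w ** (transpose C ** transpose (adjoint_mat C)) ** transpose z ** transpose P"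
      by (simp add: matrix_transpose_mul matrix_mul_assoc)
    then show ?thesis by (simp add: C1 C2 matrix_mul_assoc)
  qed
  have 4: "det B * t * det (P ** y ** adjoint_mat B) = t * det y"
    using unitary_det[OF B] by (simp add: det_mul P det_adjoint_mat mult_ac)
  have 5: "det B * t * pf4 (C ** w ** transpose C) = t * pf4 w"
    using BC by (simp add: pf4_congr w)
  have 6: "det B * pf4_polar (C ** w ** transpose C) (C ** (transpose x ** eps2 ** x) ** transpose C) = pf4_polar w (transpose x ** eps2 ** x)"
    unfolding pf4_polar_congr[OF w skew_eps2_congr] using BC by (metis mult.assoc mult_1)
  show ?thesis
    unfolding jcub_def transpose_eps2_congr 2 3 4 5 alt_congr P pf4_polar_scale 6 by simp
qed

section \<open>The homomorphism into \<open>E\<^sub>6\<close>\<close>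

lemma mip_self: "mip A A = of_real (\<Sum>i\<in>UNIV. \<Sum>j\<in>UNIV. (cmod (A $ i $ j))\<^sup>2)"
  by (simp add: mip_def mult.commute flip: complex_norm_square)

lemma mip_self_Re: "Re (mip A A) \<ge> 0" "Im (mip A A) = 0"
  by (simp_all add: mip_self sum_nonneg)

lemma mip_self_eq_0: "Re (mip A A) = 0 \<Longrightarrow> A = 0"
  by (simp add: mip_self sum_nonneg_eq_0_iff sum_nonneg vec_eq_iff)

lemma jcoords_zero: "jcoords 0 0 0 0 0 = 0"
  using jcoords_add[of 0 0 0 0 0 0 0 0 0 0] by simp

lemma jherm_self_eq_0:
  assumes X: "X \<in> jordanC" and "jherm X X = 0"
  shows "X = 0"
proof -
  obtain t w x y z where w: "skew w" "X = jcoords t w x y z" using X by (rule jordanC_cases)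
  have "0 = Re (jherm X X)" by (simp add: assms)
  also have "\<dots> = (cmod t)\<^sup>2 + Re (mip w w) / 2 + Re (mip x x) + Re (mip y y) + Re (mip z z)"
    unfolding cmod_power2 by (simp add: w jherm_jcoords power2_eq_square)
  finally have "(cmod t)\<^sup>2 = 0 \<and> Re (mip w w) = 0 \<and> Re (mip x x) = 0 \<and> Re (mip y y) = 0 \<and> Re (mip z z) = 0"
    using mip_self_Re(1)[of w] mip_self_Re(1)[of x] mip_self_Re(1)[of y] mip_self_Re(1)[of z] zero_le_power2[of "cmod t"]
    by linarith
  then show ?thesis using w(2) by (auto simp: jcoords_zero dest!: mip_self_eq_0)
qed

lemma jherm_diff: "jherm (X - Y) Z = jherm X Z - jherm Y Z"
proof -
  have "ctau (x - y) = ctau x - ctau y" for x y :: cayleyC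
    by (cases x rule: oct8_cases, cases y rule: oct8_cases) (simp add: oct8_simps)
  then have "jtau X = jtau (X - Y) + jtau Y"
    by (simp add: jtau_def vec_eq_iff)
  then have "jherm X Z = jherm (X - Y) Z + jherm Y Z"
    unfolding jherm_eq by (simp add: mmul_add_left)
  then show ?thesis by simp
qed

lemma jtri_jherm: "jtri X Y Z = jherm (jtau (jcross X Y)) Z"
  by (simp add: jtri_def jherm_def)

text \<open>The Hermitian form is positive definite, and \<open>jtau (jcross X Y)\<close> represents
  the functional \<open>jtri X Y\<close> through it. Both sides of the cross product law represent
  the same functional on the image of \<open>\<alpha>\<close>; as \<open>\<alpha>\<close> is onto,
  their difference is in that image, so it is orthogonal to itself and vanishes.\<close>

lemma E6_setI:
  assumes bij: "\<alpha> \<in> Bij jordanC"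
    and add: "\<And>X Y. X \<in> jordanC \<Longrightarrow> Y \<in> jordanC \<Longrightarrow> \<alpha> (X + Y) = \<alpha> X + \<alpha> Y"
    and scale: "\<And>c X. X \<in> jordanC \<Longrightarrow> \<alpha> (mscale c X) = mscale c (\<alpha> X)"
    and cub: "\<And>X. X \<in> jordanC \<Longrightarrow> jtri (\<alpha> X) (\<alpha> X) (\<alpha> X) = jtri X X X"
    and herm: "\<And>X Y. X \<in> jordanC \<Longrightarrow> Y \<in> jordanC \<Longrightarrow> jherm (\<alpha> X) (\<alpha> Y) = jherm X Y"
  shows "\<alpha> \<in> E6_set"
proof -
  have bb: "bij_betw \<alpha> jordanC jordanC" using bij by (simp add: Bij_def)
  have cl: "\<alpha> X \<in> jordanC" if "X \<in> jordanC" for X using bij_betwE[OF bb] that by auto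
  have "jcross (\<alpha> X) (\<alpha> Y) = jtau (\<alpha> (jtau (jcross X Y)))" if XY: "X \<in> jordanC" "Y \<in> jordanC" for X Y
  proof -
    let ?A = "jtau (jcross (\<alpha> X) (\<alpha> Y))" and ?B = "\<alpha> (jtau (jcross X Y))"
    have D: "?A - ?B \<in> jordanC" by (intro jordanC_diff jordanC_jtau jordanC_jcross cl XY)
    then have "?A - ?B \<in> \<alpha> ` jordanC" by (simp only: bij_betw_imp_surj_on[OF bb])
    then obtain Z where Z: "?A - ?B = \<alpha> Z" "Z \<in> jordanC" by (rule imageE)
    have "jherm ?A (\<alpha> Z) = jtri X Y Z"
      unfolding jtri_jherm[symmetric] by (rule jtri_polarize[where S = jordanC]) (auto simp: add cub XY Z jordanC_add)
    moreover have "jherm ?B (\<alpha> Z) = jtri X Y Z"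
      unfolding jtri_jherm by (intro herm jordanC_jtau jordanC_jcross XY Z)
    ultimately have "jherm (?A - ?B) (?A - ?B) = 0"
      by (simp add: Z(1)[symmetric] jherm_diff)
    then have "?A = ?B" using jherm_self_eq_0[OF D] by simp
    then show ?thesis by (metis jtau_jtau)
  qed
  then show ?thesis using assms by (simp add: E6_set_def IsoC_def)
qed

lemma E6_cubic:
  assumes a: "\<alpha> \<in> E6_set" and X: "X \<in> jordanC"
  shows "jtri (\<alpha> X) (\<alpha> X) (\<alpha> X) = jtri X X X"
proof -
  have "jtri (\<alpha> X) (\<alpha> X) (\<alpha> X) = jherm (\<alpha> (jtau (jcross X X))) (\<alpha> X)"
    using a X by (simp add: jtri_jherm E6_set_def)
  also have "\<dots> = jtri X X X"
    using a X by (simp add: jtri_jherm E6_set_def jordanC_jtau jordanC_jcross)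
  finally show ?thesis .
qed

text \<open>The block form of \<open>S \<mapsto> A S A\<^sup>T\<close>,
  \<open>v \<mapsto> P v A\<^sup>*\<close> for \<open>A\<close> with diagonal blocks
  \<open>B\<close> and \<open>C\<close>; the factor \<open>det B\<close> on \<open>t\<close> comes
  from \<open>eps2_congr\<close>. Coordinates are unique once \<open>w\<close> is skew, so
  \<open>THE\<close> is well defined, and \<open>restrict\<close> supplies the extensionality
  required by \<open>Bij\<close>.\<close>

definition jact :: "complex^2^2 \<Rightarrow> complex^2^2 \<Rightarrow> complex^4^4 \<Rightarrow> matC \<Rightarrow> matC" where
  "jact P B C = (\<lambda>X\<in>jordanC. THE Y. \<exists>t w x y z. skew w \<and> X = jcoords t w x y z \<and>
     Y = jcoords (det B * t) (C ** w ** transpose C) (B ** x ** transpose C) (P ** y ** adjoint_mat B) (P ** z ** adjoint_mat C))"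

lemma jact_jcoords:
  assumes "skew w"
  shows "jact P B C (jcoords t w x y z) =
    jcoords (det B * t) (C ** w ** transpose C) (B ** x ** transpose C) (P ** y ** adjoint_mat B) (P ** z ** adjoint_mat C)"
  unfolding jact_def restrict_apply'[OF jcoords_in_jordanC]
  by (rule the_equality) (use assms in blast, auto simp: jcoords_inj[OF assms])

lemma jact_closed: "X \<in> jordanC \<Longrightarrow> jact P B C X \<in> jordanC"
  by (erule jordanC_cases) (simp add: jact_jcoords)

lemma jact_jact:
  assumes "X \<in> jordanC"
  shows "jact P B C (jact P' B' C' X) = jact (P ** P') (B ** B') (C ** C') X"
  using assms
  by (rule jordanC_cases)
    (simp add: jact_jcoords skew_congr det_mul matrix_transpose_mul adjoint_mat_mul matrix_mul_assoc mult.assoc)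

lemma jact_1: "X \<in> jordanC \<Longrightarrow> jact (mat 1) (mat 1) (mat 1) X = X"
  by (erule jordanC_cases) (simp add: jact_jcoords transpose_mat)

lemma jact_Bij:
  assumes "unitary P" "unitary B" "unitary C"
  shows "jact P B C \<in> Bij jordanC"
proof -
  have "bij_betw (jact P B C) jordanC jordanC"
  proof (rule bij_betw_byWitness[where f' = "jact (adjoint_mat P) (adjoint_mat B) (adjoint_mat C)"])
    show "\<forall>X\<in>jordanC. jact (adjoint_mat P) (adjoint_mat B) (adjoint_mat C) (jact P B C X) = X"
      using assms by (simp add: jact_jact jact_1 unitary_def)
    show "\<forall>X\<in>jordanC. jact P B C (jact (adjoint_mat P) (adjoint_mat B) (adjoint_mat C) X) = X"
      using assms by (simp add: jact_jact jact_1 unitary_right)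
  qed (auto simp: jact_closed)
  then show ?thesis by (simp add: Bij_def jact_def)
qed

lemma matrix_uminus_right: "A ** (- B) = - (A ** B)" for A :: "'a::comm_ring_1^'n^'m"
  by (simp add: matrix_matrix_mult_def vec_eq_iff sum_negf)

lemma matrix_uminus_left: "(- A) ** B = - (A ** B)" for A :: "'a::comm_ring_1^'n^'m"
  by (simp add: matrix_matrix_mult_def vec_eq_iff sum_negf)

lemma jact_E6:
  assumes P: "unitary P" "det P = 1" and B: "unitary B" and C: "unitary C" and BC: "det B * det C = 1"
  shows "jact P B C \<in> carrier E6_sigma_gamma"
proof -
  have comm: "A ** (mat c ** D) = mat c ** (A ** D)" for A :: "complex^'n^'m" and D :: "complex^'k^'n" and c
    by (metis mat_mul_commute matrix_mul_assoc)
  have "jact P B C \<in> E6_set"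
  proof (rule E6_setI)
    fix X Y assume X: "X \<in> jordanC" and Y: "Y \<in> jordanC"
    obtain t w x y z where w: "skew w" "X = jcoords t w x y z" using X by (rule jordanC_cases)
    obtain t' w' x' y' z' where w': "skew w'" "Y = jcoords t' w' x' y' z'" using Y by (rule jordanC_cases)
    show "jact P B C (X + Y) = jact P B C X + jact P B C Y"
      by (simp add: w w' jact_jcoords jcoords_add skew_add matrix_add_ldistrib matrix_add_rdistrib distrib_left)
    show "jact P B C (mscale c X) = mscale c (jact P B C X)" for c
      by (simp add: w jact_jcoords mscale_jcoords skew_mat_mul comm mult_ac flip: matrix_mul_assoc)
    show "jtri (jact P B C X) (jact P B C X) (jact P B C X) = jtri X X X"
      by (simp add: w jact_jcoords jtri_jcoords skew_congr jcub_act assms)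
    have "cnj (det B * t) * (det B * t') = cnj t * t'"
      using unitary_det[OF B] by (simp add: mult_ac)
    then show "jherm (jact P B C X) (jact P B C Y) = jherm X Y"
      by (simp add: w w' jact_jcoords jherm_jcoords skew_congr mip_unitary assms unitary_adjoint unitary_transpose)
  qed (use assms jact_Bij in auto)
  moreover have "jsigma (jact P B C X) = jact P B C (jsigma X) \<and> jgamma (jact P B C X) = jact P B C (jgamma X)"
    if "X \<in> jordanC" for X
    using that
    by (rule jordanC_cases)
      (simp add: jact_jcoords jsigma_jcoords jgamma_jcoords matrix_uminus_right matrix_uminus_left)
  ultimately show ?thesis by (simp add: E6_sigma_gamma_def E6_def)
qed

text \<open>The convention for the quaternion units is that of \<open>oct8\<close>; it identifies
  Sp(1) with SU(2).\<close>

definition quat_mat :: "quat \<Rightarrow> complex^2^2" where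
  "quat_mat = (\<lambda>(a, b, c, d). vector [vector [Complex a b, Complex c d], vector [Complex (- c) d, Complex a (- b)]])"

lemma quat_mat_mul: "quat_mat (qmul p q) = quat_mat p ** quat_mat q"
  by (cases p, cases q)
    (simp add: quat_mat_def vec_eq_iff forall_2 matrix_matrix_mult_def sum_2 complex_eq_iff algebra_simps)

lemma Sp1_iff: "(a, b, c, d) \<in> carrier Sp1 \<longleftrightarrow> a\<^sup>2 + b\<^sup>2 + c\<^sup>2 + d\<^sup>2 = 1"
  by (auto simp: Sp1_def qone_def power2_eq_square algebra_simps)

lemma quat_mat_Sp1:
  assumes "p \<in> carrier Sp1"
  shows "unitary (quat_mat p)" "det (quat_mat p) = 1"
proof -
  obtain a b c d where p: "p = (a, b, c, d)" by (metis surj_pair)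
  with assms have *: "a\<^sup>2 + b\<^sup>2 + c\<^sup>2 + d\<^sup>2 = 1" by (simp add: Sp1_iff)
  then show "unitary (quat_mat p)" "det (quat_mat p) = 1"
    by (simp_all add: p unitary_def quat_mat_def vec_eq_iff forall_2 matrix_matrix_mult_def sum_2 complex_eq_iff 
        det_2 mat_def power2_eq_square algebra_simps)
qed

text \<open>For determinant 1 the inverse is the adjugate \<open>N\<close>, and for a unitary matrix
  it is the adjoint. Comparing the two entrywise gives the shape of a real quaternion.\<close>

lemma quat_mat_surj:
  assumes "unitary P" "det P = 1"
  obtains p where "p \<in> carrier Sp1" "P = quat_mat p"
proof -
  define N where "N = (vector [vector [P$2$2, - P$1$2], vector [- P$2$1, P$1$1]] :: complex^2^2)"
  have "P ** N = mat 1"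
    using assms(2) by (simp add: N_def vec_eq_iff forall_2 matrix_matrix_mult_def sum_2 det_2 mat_def algebra_simps)
  then have "adjoint_mat P ** (P ** N) = adjoint_mat P" by simp
  then have N: "adjoint_mat P = N" using assms(1) by (simp add: matrix_mul_assoc unitary_def)
  have 1: "P$2$2 = cnj (P$1$1)" "P$2$1 = - cnj (P$1$2)"
    using arg_cong[OF N, of "\<lambda>M. M$1$1"] arg_cong[OF N, of "\<lambda>M. M$2$1"] by (simp_all add: N_def)
  define p :: quat where "p = (Re (P$1$1), Im (P$1$1), Re (P$1$2), Im (P$1$2))"
  have P: "P = quat_mat p"
    by (simp add: vec_eq_iff forall_2 quat_mat_def p_def 1 complex_eq_iff)
  have "p \<in> carrier Sp1"
    using assms(2) unfolding p_def Sp1_iff det_2 1 by (simp add: complex_eq_iff power2_eq_square algebra_simps)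
  with P that show ?thesis by blast
qed

section \<open>Block-diagonal matrices\<close>

definition bdiag :: "complex^('a::finite + 'b::finite)^('a + 'b) \<Rightarrow> bool" where
  "bdiag A \<longleftrightarrow> (\<forall>i j. A $ Inl i $ Inr j = 0 \<and> A $ Inr j $ Inl i = 0)"

lemma bdiag_eq_iff:
  assumes "bdiag A" "bdiag A'"
  shows "A = A' \<longleftrightarrow> blkl A = blkl A' \<and> blkr A = blkr A'"
  using assms unfolding vec_eq_iff bdiag_def blkl_def blkr_def by (auto simp: split_sum_all)

lemma bdiag_mul:
  assumes "bdiag A" "bdiag A'"
  shows "bdiag (A ** A')" "blkl (A ** A') = blkl A ** blkl A'" "blkr (A ** A') = blkr A ** blkr A'"
  using assms by (simp_all add: bdiag_def blkl_def blkr_def matrix_matrix_mult_def sum_UNIV_sum vec_eq_iff)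

lemma bdiag_adjoint:
  "bdiag A \<Longrightarrow> bdiag (adjoint_mat A)" "blkl (adjoint_mat A) = adjoint_mat (blkl A)" "blkr (adjoint_mat A) = adjoint_mat (blkr A)"
  by (simp_all add: bdiag_def blkl_def blkr_def vec_eq_iff)

lemma bdiag_mat [simp]: "bdiag (mat c)" "blkl (mat c) = mat c" "blkr (mat c) = mat c"
  by (simp_all add: bdiag_def blkl_def blkr_def mat_def vec_eq_iff)

lemma bdiag_exists:
  fixes B :: "complex^'a::finite^'a" and C :: "complex^'b::finite^'b"
  obtains A where "bdiag A" "blkl A = B" "blkr A = C"
proof
  let ?A = "(\<chi> i j. case i of Inl a \<Rightarrow> (case j of Inl b \<Rightarrow> B $ a $ b | Inr b \<Rightarrow> 0)
       | Inr a \<Rightarrow> (case j of Inl b \<Rightarrow> 0 | Inr b \<Rightarrow> C $ a $ b)) :: complex^('a + 'b)^('a + 'b)"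
  show "bdiag ?A" "blkl ?A = B" "blkr ?A = C"
    by (simp_all add: bdiag_def blkl_def blkr_def vec_eq_iff)
qed

lemma S_U2_U4_iff: "A \<in> carrier S_U2_U4 \<longleftrightarrow>
    bdiag A \<and> unitary (blkl A) \<and> unitary (blkr A) \<and> det (blkl A) * det (blkr A) = 1"
proof -
  have "A \<in> carrier S_U2_U4 \<longleftrightarrow> bdiag A \<and> adjoint_mat A ** A = mat 1 \<and> det A = 1"
    by (auto simp: S_U2_U4_def SU6_def bdiag_def)
  moreover have "det A = det (blkl A) * det (blkr A)" if "bdiag A"
    using that by (intro det_block_triangular) (simp add: bdiag_def)
  moreover have "adjoint_mat A ** A = mat 1 \<longleftrightarrow> unitary (blkl A) \<and> unitary (blkr A)" if "bdiag A"
    using that by (subst bdiag_eq_iff) (simp_all add: bdiag_mul bdiag_adjoint unitary_def)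
  ultimately show ?thesis by auto
qed

section \<open>The group structures and the homomorphism\<close>

lemma group_Sp1: "group Sp1"
proof (rule groupI)
  have assoc: "qmul (qmul p q) r = qmul p (qmul q r)" for p q r
    by (cases p, cases q, cases r) (simp add: algebra_simps)
  fix x y z assume "x \<in> carrier Sp1" "y \<in> carrier Sp1" "z \<in> carrier Sp1"
  then show "x \<otimes>\<^bsub>Sp1\<^esub> y \<in> carrier Sp1"
  proof (cases x, cases y)
    fix a b c d a' b' c' d' assume xy: "x = (a, b, c, d)" "y = (a', b', c', d')"
    have "(a\<^sup>2 + b\<^sup>2 + c\<^sup>2 + d\<^sup>2) * (a'\<^sup>2 + b'\<^sup>2 + c'\<^sup>2 + d'\<^sup>2) = 1"
      using \<open>x \<in> carrier Sp1\<close> \<open>y \<in> carrier Sp1\<close> by (simp add: xy Sp1_iff)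
    \<comment> \<open>Euler's four-square identity.\<close>
    moreover have "(a * a' - b * b' - c * c' - d * d')\<^sup>2 + (a * b' + b * a' + c * d' - d * c')\<^sup>2 +
        (a * c' - b * d' + c * a' + d * b')\<^sup>2 + (a * d' + b * c' - c * b' + d * a')\<^sup>2
      = (a\<^sup>2 + b\<^sup>2 + c\<^sup>2 + d\<^sup>2) * (a'\<^sup>2 + b'\<^sup>2 + c'\<^sup>2 + d'\<^sup>2)"
      by algebra
    moreover have "x \<otimes>\<^bsub>Sp1\<^esub> y = qmul x y" by (simp add: Sp1_def)
    ultimately show ?thesis
      by (simp add: xy Sp1_iff)
  qed
  show "(x \<otimes>\<^bsub>Sp1\<^esub> y) \<otimes>\<^bsub>Sp1\<^esub> z = x \<otimes>\<^bsub>Sp1\<^esub> (y \<otimes>\<^bsub>Sp1\<^esub> z)"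
    by (simp add: Sp1_def assoc)
  show "\<one>\<^bsub>Sp1\<^esub> \<otimes>\<^bsub>Sp1\<^esub> x = x"
    by (cases x) (simp add: Sp1_def qone_def)
  have "qcnj x \<in> carrier Sp1"
    using \<open>x \<in> carrier Sp1\<close> by (cases x) (simp add: Sp1_iff)
  moreover have "qcnj x \<otimes>\<^bsub>Sp1\<^esub> x = \<one>\<^bsub>Sp1\<^esub>"
    using \<open>x \<in> carrier Sp1\<close> by (simp add: Sp1_def)
  ultimately show "\<exists>y\<in>carrier Sp1. y \<otimes>\<^bsub>Sp1\<^esub> x = \<one>\<^bsub>Sp1\<^esub>" by blast
next
  show "\<one>\<^bsub>Sp1\<^esub> \<in> carrier Sp1" by (simp add: Sp1_def qone_def)
qed

lemma group_S_U2_U4: "group S_U2_U4"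
proof (rule groupI)
  have m: "x \<otimes>\<^bsub>S_U2_U4\<^esub> y = x ** y" and o: "\<one>\<^bsub>S_U2_U4\<^esub> = mat 1" for x y
    by (simp_all add: S_U2_U4_def SU6_def)
  fix x y z assume x: "x \<in> carrier S_U2_U4" and y: "y \<in> carrier S_U2_U4" and z: "z \<in> carrier S_U2_U4"
  have "det (blkl x) * det (blkl y) * (det (blkr x) * det (blkr y)) = (det (blkl x) * det (blkr x)) * (det (blkl y) * det (blkr y))"
    by simp
  with x y show "x \<otimes>\<^bsub>S_U2_U4\<^esub> y \<in> carrier S_U2_U4"
    unfolding m S_U2_U4_iff by (simp add: bdiag_mul det_mul unitary_mul)
  show "(x \<otimes>\<^bsub>S_U2_U4\<^esub> y) \<otimes>\<^bsub>S_U2_U4\<^esub> z = x \<otimes>\<^bsub>S_U2_U4\<^esub> (y \<otimes>\<^bsub>S_U2_U4\<^esub> z)"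
    by (simp add: m matrix_mul_assoc)
  show "\<one>\<^bsub>S_U2_U4\<^esub> \<otimes>\<^bsub>S_U2_U4\<^esub> x = x" by (simp add: m o)
  have "adjoint_mat x \<in> carrier S_U2_U4"
    using x unfolding S_U2_U4_iff
    by (simp add: bdiag_adjoint unitary_adjoint det_adjoint_mat flip: complex_cnj_mult)
  moreover have "adjoint_mat x \<otimes>\<^bsub>S_U2_U4\<^esub> x = \<one>\<^bsub>S_U2_U4\<^esub>"
    using x unfolding m o by (simp add: S_U2_U4_def SU6_def)
  ultimately show "\<exists>y\<in>carrier S_U2_U4. y \<otimes>\<^bsub>S_U2_U4\<^esub> x = \<one>\<^bsub>S_U2_U4\<^esub>" by blast
next
  show "\<one>\<^bsub>S_U2_U4\<^esub> \<in> carrier S_U2_U4"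
    unfolding S_U2_U4_iff by (simp add: S_U2_U4_def SU6_def unitary_def)
qed

definition phi :: "quat \<times> mat6 \<Rightarrow> matC \<Rightarrow> matC" where
  "phi = (\<lambda>(p, A). jact (quat_mat p) (blkl A) (blkr A))"

lemma phi_closed: "u \<in> carrier (Sp1 \<times>\<times> S_U2_U4) \<Longrightarrow> phi u \<in> carrier E6_sigma_gamma"
  by (cases u) (auto simp: phi_def S_U2_U4_iff intro!: jact_E6 quat_mat_Sp1)

lemma phi_hom: "phi \<in> hom (Sp1 \<times>\<times> S_U2_U4) E6_sigma_gamma"
proof (rule homI)
  fix u v assume u: "u \<in> carrier (Sp1 \<times>\<times> S_U2_U4)" and v: "v \<in> carrier (Sp1 \<times>\<times> S_U2_U4)"
  obtain p A q D where uv: "u = (p, A)" "v = (q, D)" by (metis surj_pair)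
  have ad: "bdiag A" "bdiag D" using u v by (auto simp: uv S_U2_U4_iff)
  have B: "phi w \<in> Bij jordanC" if "w \<in> carrier (Sp1 \<times>\<times> S_U2_U4)" for w
    using phi_closed[OF that] by (simp add: E6_sigma_gamma_def E6_def E6_set_def IsoC_def)
  have "phi (u \<otimes>\<^bsub>Sp1 \<times>\<times> S_U2_U4\<^esub> v) = jact (quat_mat p ** quat_mat q) (blkl A ** blkl D) (blkr A ** blkr D)"
    by (simp add: uv phi_def Sp1_def S_U2_U4_def SU6_def quat_mat_mul bdiag_mul ad)
  also have "\<dots> = compose jordanC (phi u) (phi v)"
    by (rule ext) (auto simp: compose_def uv phi_def jact_jact, simp add: jact_def)
  also have "\<dots> = phi u \<otimes>\<^bsub>E6_sigma_gamma\<^esub> phi v"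
    using B[OF u] B[OF v] by (simp add: E6_sigma_gamma_def E6_def BijGroup_def)
  finally show "phi (u \<otimes>\<^bsub>Sp1 \<times>\<times> S_U2_U4\<^esub> v) = phi u \<otimes>\<^bsub>E6_sigma_gamma\<^esub> phi v" .
qed (rule phi_closed)

section \<open>Surjectivity\<close>

definition munit :: "'m::finite \<Rightarrow> 'n::finite \<Rightarrow> complex^'n^'m" where
  "munit i j = (\<chi> a b. if a = i \<and> b = j then 1 else 0)"

definition clin_mat :: "(complex^'n^'m \<Rightarrow> complex^'l^'k) \<Rightarrow> bool" where
  "clin_mat f \<longleftrightarrow> (\<forall>A B. f (A + B) = f A + f B) \<and> (\<forall>c A. f (mat c ** A) = mat c ** f A)"

lemma clin_mat_zero: "clin_mat f \<Longrightarrow> f 0 = 0"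
  unfolding clin_mat_def by (metis add_cancel_right_right)

lemma clin_mat_sum: "clin_mat f \<Longrightarrow> f (sum g S) = (\<Sum>i\<in>S. f (g i))"
  by (induction S rule: infinite_finite_induct) (simp_all add: clin_mat_zero clin_mat_def)

lemma munit_nth: "munit a b $ i $ j = (if i = a \<and> j = b then 1 else 0)"
  by (simp add: munit_def)

lemma munit_mul_left: "(munit a b ** A) $ i $ j = (if i = a then A $ b $ j else 0)"
  by (auto simp: munit_def matrix_matrix_mult_def mult_delta_left mult_delta_right)

lemma munit_mul_right: "(B ** munit a b) $ i $ j = (if j = b then B $ i $ a else 0)"
  by (auto simp: munit_def matrix_matrix_mult_def mult_delta_left mult_delta_right)

lemma mat_expand: "A = (\<Sum>i\<in>UNIV. \<Sum>j\<in>UNIV. mat (A $ i $ j) ** munit i j)"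
proof -
  have "(\<Sum>i\<in>UNIV. \<Sum>j\<in>UNIV. A $ i $ j * munit i j $ a $ b) = A $ a $ b" for a b
  proof -
    have "(\<Sum>i\<in>UNIV. \<Sum>j\<in>UNIV. A $ i $ j * munit i j $ a $ b) = (\<Sum>i\<in>UNIV. if i = a then A $ i $ b else 0)"
      by (rule sum.cong[OF refl]) (auto simp: munit_nth mult_delta_right)
    then show ?thesis by simp
  qed
  then show ?thesis by (simp add: vec_eq_iff)
qed

lemma clin_mat_expand: "clin_mat f \<Longrightarrow> f A = (\<Sum>i\<in>UNIV. \<Sum>j\<in>UNIV. mat (A $ i $ j) ** f (munit i j))"
  by (subst (1) mat_expand) (simp add: clin_mat_sum, simp add: clin_mat_def)

lemma mip_munit: "mip (munit a b) A = A $ a $ b"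
proof -
  have c: "cnj (munit a b $ i $ j) = munit a b $ i $ j" for i j by (simp add: munit_nth)
  have "mip (munit a b) A = (\<Sum>i\<in>UNIV. if i = a then A $ i $ b else 0)"
    unfolding mip_def c by (rule sum.cong[OF refl]) (auto simp: munit_nth mult_delta_left)
  then show ?thesis by simp
qed

lemma mip_nondeg: "(\<And>X. mip X A = mip X B) \<Longrightarrow> A = B"
  by (simp add: vec_eq_iff flip: mip_munit)

text \<open>Moving the factors across \<open>mip\<close> gives \<open>S ** x ** T = x\<close> for
  all \<open>x\<close>. Matrix units force \<open>S\<close> and \<open>T\<close> to be scalars
  \<open>l\<close> and \<open>1 / l\<close>. Since \<open>l\<close> is the squared norm of a column
  of \<open>Q\<close>, it is positive, and \<open>c\<close> with \<open>cnj c * c = 1 / l\<close>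
  normalizes both factors.\<close>

lemma isometry_unitary:
  fixes Q :: "complex^'m^'m" and D :: "complex^'n^'n"
  assumes "\<And>x x'. mip (Q ** x ** D) (Q ** x' ** D) = mip x x'"
  obtains c where "c \<noteq> 0" "unitary (mat c ** Q)" "unitary (mat (1 / c) ** D)"
proof -
  define S where "S = adjoint_mat Q ** Q"
  define T where "T = D ** adjoint_mat D"
  have ST: "S ** x ** T = x" for x
    using assms[of _ x] by (intro mip_nondeg) (simp add: mip_mul_left mip_mul_right S_def T_def matrix_mul_assoc)
  have st: "S $ i $ a * T $ b $ j = (if i = a \<and> j = b then 1 else 0)" for i a b j
  proof -
    have "(S ** munit a b ** T) $ i $ j = S $ i $ a * T $ b $ j"
      by (simp add: matrix_matrix_mult_def[of _ T] munit_mul_left munit_mul_right mult_delta_left)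
    then show ?thesis by (simp add: ST munit_nth)
  qed
  obtain a :: 'm and b :: 'n where True by simp
  define l where "l = S $ a $ a"
  have l1: "l * T $ b' $ b' = 1" for b' using st[of a a b' b'] by (simp add: l_def)
  then have l0: "l \<noteq> 0" by auto
  have T: "T = mat (1 / l)"
  proof -
    have "T $ i $ j = (if i = j then 1 / l else 0)" for i j
      using st[of a a i j] l0 by (auto simp: l_def field_simps split: if_splits)
    then show ?thesis by (simp add: vec_eq_iff mat_def)
  qed
  have S: "S = mat l"
  proof -
    have "S $ i $ j = (if i = j then l else 0)" for i j
      using st[of i j b b] l0 by (auto simp: T mat_def field_simps split: if_splits)
    then show ?thesis by (simp add: vec_eq_iff mat_def)
  qed
  define r where "r = (\<Sum>k\<in>UNIV. (cmod (Q $ k $ a))\<^sup>2)"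
  have lr: "l = of_real r"
    by (simp add: l_def S_def matrix_matrix_mult_def r_def mult.commute flip: complex_norm_square)
  have "r > 0" using l0 lr by (metis of_real_0 order_le_less r_def sum_nonneg zero_le_power2)
  define c where "c = complex_of_real (1 / sqrt r)"
  have c0: "c \<noteq> 0" using \<open>r > 0\<close> by (simp add: c_def)
  have "cnj c * c = of_real ((1 / sqrt r) * (1 / sqrt r))"
    by (simp only: c_def complex_cnj_complex_of_real of_real_mult)
  also have "(1 / sqrt r) * (1 / sqrt r) = 1 / r" using \<open>r > 0\<close> by simp
  also have "complex_of_real (1 / r) = 1 / l" by (simp add: lr)
  finally have cc: "cnj c * c = 1 / l" .
  have mm: "mat u ** mat v = (mat (u * v) :: complex^'k^'k)" for u v
    by (simp add: vec_eq_iff) (simp add: mat_def)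
  have "unitary (mat c ** Q)"
  proof -
    have "adjoint_mat (mat c ** Q) ** (mat c ** Q) = adjoint_mat Q ** mat (cnj c) ** mat c ** Q"
      by (simp add: adjoint_mat_mul matrix_mul_assoc)
    also have "adjoint_mat Q ** mat (cnj c) ** mat c = mat (cnj c * c) ** adjoint_mat Q"
      by (metis mat_mul_commute matrix_mul_assoc mm)
    also have "mat (cnj c * c) ** adjoint_mat Q ** Q = mat (cnj c * c) ** S"
      by (simp add: S_def matrix_mul_assoc)
    finally show ?thesis using l0 by (simp add: unitary_def S mm cc)
  qed
  moreover have "unitary (adjoint_mat (mat (1 / c) ** D))"
  proof -
    have "(mat (1 / c) ** D) ** adjoint_mat (mat (1 / c) ** D) = mat (1 / c) ** (D ** adjoint_mat D ** mat (cnj (1 / c)))"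
      by (simp add: adjoint_mat_mul matrix_mul_assoc)
    also have "\<dots> = mat (1 / (cnj c * c) * (1 / l))"
      by (simp add: T_def[symmetric] T mm mult_ac)
    finally show ?thesis using l0 by (simp add: unitary_def cc)
  qed
  then have "unitary (mat (1 / c) ** D)" using unitary_adjoint by fastforce
  ultimately show ?thesis using that c0 by blast
qed

lemma alt_diff: "alt (A - B) = alt A - alt B"
  by (simp add: alt_def)

text \<open>Pairing with \<open>munit 1 j\<close> and \<open>munit 2 j\<close> reads off the entries
  of column \<open>j\<close> up to sign.\<close>

lemma alt_nondeg:
  fixes M :: "complex^'n^2"
  assumes "\<And>z. alt (M ** transpose z) = 0"
  shows "M = 0"
proof -
  have "M $ i $ j = 0" for i j
  proof -
    have "alt (M ** transpose (munit 1 j)) = - M $ 2 $ j" "alt (M ** transpose (munit 2 j)) = M $ 1 $ j"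
      by (simp_all add: alt_def matrix_matrix_mult_def transpose_def munit_nth mult_delta_right)
    then have "M $ 1 $ j = 0 \<and> M $ 2 $ j = 0" using assms by (metis neg_equal_0_iff_equal)
    then show ?thesis by (metis exhaust_2)
  qed
  then show ?thesis by (simp add: vec_eq_iff)
qed

lemma alt_transpose: "alt (transpose M) = - alt M"
  by (simp add: alt_def transpose_def)

lemma alt_nondeg_left:
  fixes n :: "complex^'n^2"
  assumes "\<And>M. alt (M ** transpose n) = 0"
  shows "n = 0"
proof (rule alt_nondeg)
  fix z
  show "alt (n ** transpose z) = 0"
    using assms[of z] alt_transpose[of "z ** transpose n"] by (simp add: matrix_transpose_mul transpose_transpose)
qed

text \<open>A Schur argument. If \<open>Q\<close> is singular, its adjugate \<open>N\<close>
  satisfies \<open>Q ** N = 0\<close>, and the intertwining relation spreads this to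
  \<open>Q ** y ** N = 0\<close> for all \<open>y\<close>. On matrix units this says that
  \<open>Q\<close> or \<open>N\<close> vanishes, hence \<open>Q\<close> does.\<close>

lemma intertwiner_det:
  fixes Q :: "complex^2^2"
  assumes h: "\<And>y. h y ** Q = Q ** y" and Q: "Q \<noteq> 0"
  shows "det Q \<noteq> 0"
proof
  assume d: "det Q = 0"
  define N where "N = (vector [vector [Q$2$2, - Q$1$2], vector [- Q$2$1, Q$1$1]] :: complex^2^2)"
  have "Q ** N = 0"
    using d by (simp add: N_def vec_eq_iff forall_2 matrix_matrix_mult_def sum_2 det_2 algebra_simps)
  then have "Q ** y ** N = 0" for y
  proof -
    have "Q ** y ** N = h y ** (Q ** N)" by (simp only: h matrix_mul_assoc)
    also have "\<dots> = 0" unfolding \<open>Q ** N = 0\<close> by (simp add: matrix_matrix_mult_def vec_eq_iff)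
    finally show ?thesis .
  qed
  then have *: "(Q ** munit a b ** N) $ i $ j = 0" for a b i j by simp
  have **: "Q $ i $ a * N $ b $ j = 0" for a b i j
    using *[of a b i j] by (simp add: matrix_matrix_mult_def[of _ N] munit_mul_left munit_mul_right mult_delta_left)
  obtain i a where "Q $ i $ a \<noteq> 0" using Q by (auto simp: vec_eq_iff)
  then have "N $ b $ j = 0" for b j using **[of i a b j] by simp
  then have "N $ 1 $ 1 = 0 \<and> N $ 1 $ 2 = 0 \<and> N $ 2 $ 1 = 0 \<and> N $ 2 $ 2 = 0" by blast
  then have "Q = 0" by (simp add: N_def vec_eq_iff forall_2)
  then show False using Q by simp
qed

text \<open>Every matrix unit is a left multiple of one in the fixed row \<open>o1\<close>, so
  \<open>g\<close> is determined by its values on that row; these are collected as the rows of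
  \<open>D\<close>.\<close>

lemma module_map:
  fixes g :: "complex^'n^'m \<Rightarrow> complex^'n^'m"
  assumes g: "clin_mat g" and gy: "\<And>y x. g (y ** x) = y ** g x"
  obtains D where "\<And>x. g x = x ** D"
proof -
  obtain o1 :: 'm where True by simp
  define D where "D = (\<chi> k j. g (munit o1 k) $ o1 $ j)"
  have u: "munit r k = (munit r o1 :: complex^'m^'m) ** munit o1 k" for r and k :: 'n
    by (simp add: vec_eq_iff munit_mul_left munit_mul_right) (simp add: munit_nth)
  have e: "g (munit r k) $ i $ j = (if i = r then D $ k $ j else 0)" for r k i j
    by (subst u) (simp add: gy munit_mul_left munit_mul_right D_def)
  have "g x = x ** D" for x
  proof -
    have "g x $ i $ j = (x ** D) $ i $ j" for i j
    proof -
      have "g x $ i $ j = (\<Sum>r\<in>UNIV. \<Sum>k\<in>UNIV. x $ r $ k * (if i = r then D $ k $ j else 0))"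
        by (subst clin_mat_expand[OF g]) (simp add: e)
      also have "\<dots> = (\<Sum>r\<in>UNIV. if i = r then \<Sum>k\<in>UNIV. x $ r $ k * D $ k $ j else 0)"
        by (intro sum.cong refl) auto
      finally show ?thesis by (simp add: matrix_matrix_mult_def)
    qed
    then show ?thesis by (simp add: vec_eq_iff)
  qed
  then show ?thesis by (rule that)
qed

text \<open>The maps are recovered in turn: nondegeneracy of \<open>alt\<close> eliminates
  \<open>fz\<close>, a Schur argument puts \<open>fx\<close> and \<open>fy\<close> into product
  form, isometry makes the factors unitary, and invariance then leaves only one possible
  \<open>fz\<close>.\<close>

lemma intertwining_triple:
  fixes fx fz :: "complex^'n^2 \<Rightarrow> complex^'n^2" and fy :: "complex^2^2 \<Rightarrow> complex^2^2"
  assumes lin: "clin_mat fx"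
    and iso: "\<And>x x'. mip (fx x) (fx x') = mip x x'" "\<And>y y'. mip (fy y) (fy y') = mip y y'"
    and surj: "surj fz" and det1: "det (fy (mat 1)) \<noteq> 0"
    and alt: "\<And>x y z. alt (fy y ** fx x ** transpose (fz z)) = alt (y ** x ** transpose z)"
  obtains P B C where "unitary P" "det P = 1" "unitary B" "unitary C" "\<And>x. fx x = B ** x ** transpose C"
    "\<And>y. fy y = P ** y ** adjoint_mat B" "\<And>z. fz z = P ** z ** adjoint_mat C"
proof -
  \<comment> \<open>By invariance both sides pair equally with every \<open>fz z'\<close>; as
    \<open>fz\<close> is onto, nondegeneracy applies.\<close>
  have com: "fy y ** fx x = fy (mat 1) ** fx (y ** x)" for x y
  proof -
    have "alt ((fy y ** fx x - fy (mat 1) ** fx (y ** x)) ** transpose z) = 0" for z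
    proof -
      obtain z' where z: "z = fz z'" using surj by (metis surjD)
      have d: "(A - B) ** C = A ** C - B ** C" for A B :: "complex^'n^2" and C :: "complex^2^'n"
        using matrix_add_rdistrib[of "A - B" B C] by simp
      show ?thesis using alt[of y x z'] alt[of "mat 1" "y ** x" z'] by (simp add: d alt_diff z)
    qed
    then show ?thesis using alt_nondeg by fastforce
  qed
  obtain F where F: "F ** fy (mat 1) = mat 1" "fy (mat 1) ** F = mat 1"
    using det1 invertible_det_nz[of "fy (mat 1)"] unfolding invertible_def by blast
  define h where "h = (\<lambda>y. F ** fy y)"
  have hx: "fx (y ** x) = h y ** fx x" for x y
    unfolding h_def by (metis com F(1) matrix_mul_assoc matrix_mul_lid)
  have hy: "fy y = fy (mat 1) ** h y" for y
    unfolding h_def by (simp add: matrix_mul_assoc F)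
  \<comment> \<open>\<open>Q k j\<close> is the part of \<open>fx\<close> from column
    \<open>k\<close> of the argument to column \<open>j\<close> of the value. Each such part
    intertwines \<open>y\<close> with \<open>h y\<close>.\<close>
  define Q where "Q = (\<lambda>k j. (\<chi> i r. fx (munit r k) $ i $ j) :: complex^2^2)"
  have hQ: "h y ** Q k j = Q k j ** y" for y k j
  proof -
    have "(h y ** Q k j) $ i $ s = (Q k j ** y) $ i $ s" for i s
    proof -
      have "(h y ** Q k j) $ i $ s = (h y ** fx (munit s k)) $ i $ j"
        by (simp add: Q_def matrix_matrix_mult_def)
      also have "\<dots> = fx (y ** munit s k) $ i $ j" by (simp add: hx)
      also have "y ** munit s k = (\<Sum>r\<in>UNIV. mat (y $ r $ s) ** munit r k)"
        by (simp add: vec_eq_iff munit_mul_left munit_mul_right) (simp add: munit_nth mult_delta_right mat_def)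
      also have "fx (\<Sum>r\<in>UNIV. mat (y $ r $ s) ** munit r k) = (\<Sum>r\<in>UNIV. mat (y $ r $ s) ** fx (munit r k))"
        using lin by (simp add: clin_mat_sum) (simp add: clin_mat_def)
      finally show ?thesis by (simp add: Q_def matrix_matrix_mult_def[of _ y] mult.commute)
    qed
    then show ?thesis by (simp add: vec_eq_iff)
  qed
  have "\<exists>k j. Q k j \<noteq> 0"
  proof (rule ccontr)
    assume "\<nexists>k j. Q k j \<noteq> 0"
    then have "fx (munit r k) $ i $ j = 0" for r k i j
      unfolding Q_def vec_eq_iff by simp
    then have "fx (munit 1 k) = 0" for k by (simp add: vec_eq_iff)
    then have "mip (munit 1 k) (munit 1 k :: complex^'n^2) = 0" for k
      using iso(1)[of "munit 1 k" "munit 1 k"] by (simp add: mip_def)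
    then show False by (simp add: mip_munit) (simp add: munit_def)
  qed
  then obtain k j where Q0: "Q k j \<noteq> 0" by blast
  define q where "q = Q k j"
  have hq: "h y ** q = q ** y" for y by (simp add: q_def hQ)
  have "det q \<noteq> 0" using intertwiner_det[of h q] hq Q0 by (simp add: q_def)
  then obtain qi where qi: "q ** qi = mat 1" "qi ** q = mat 1"
    using invertible_det_nz[of q] unfolding invertible_def by blast
  have hqy: "h y = q ** y ** qi" for y
    by (metis hq matrix_mul_assoc matrix_mul_rid qi(1))
  \<comment> \<open>Removing \<open>q\<close> leaves a map that commutes with left multiplication,
    hence a right multiplication.\<close>
  define g where "g = (\<lambda>x. qi ** fx x)"
  have "g (y ** x) = y ** g x" for y x
    by (simp add: g_def hx hqy matrix_mul_assoc qi)
  moreover have "clin_mat g"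
    using lin unfolding clin_mat_def g_def
    by (metis (no_types, lifting) mat_mul_commute matrix_add_ldistrib matrix_mul_assoc)
  ultimately obtain D where D: "g x = x ** D" for x using module_map by blast
  have fx: "fx x = q ** x ** D" for x
    using D[of x] by (metis g_def matrix_mul_assoc matrix_mul_lid qi(1))
  obtain c where c: "c \<noteq> 0" "unitary (mat c ** q)" "unitary (mat (1 / c) ** D)"
    using isometry_unitary[of q D] iso(1) by (auto simp: fx)
  have cm: "A ** (mat u ** E) = mat u ** (A ** E)" for A :: "complex^'k^'m" and E :: "complex^'l^'k" and u
    by (metis mat_mul_commute matrix_mul_assoc)
  have mm: "mat u ** (mat v ** A) = mat (u * v) ** A" for u v and A :: "complex^'k^'m"
    by (simp add: vec_eq_iff)
  have ml: "(mat u ** A) ** E = mat u ** (A ** E)" for A :: "complex^'k^'m" and E :: "complex^'l^'k" and u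
    by (simp add: matrix_mul_assoc)
  have sc: "(mat u ** A) ** X ** (mat v ** E) = mat (u * v) ** (A ** X ** E)"
    for A :: "complex^'k^'m" and X :: "complex^'l^'k" and E :: "complex^'o^'l" and u v
    by (simp only: ml cm[of "A ** X"] mm)
  \<comment> \<open>Rescaling by \<open>c\<close> makes both factors of \<open>fx\<close> unitary.
    Then \<open>qi\<close> is \<open>c\<close> times the adjoint of \<open>B1\<close>, and
    \<open>P1\<close> absorbs this \<open>c\<close>.\<close>
  define B1 where "B1 = mat c ** q"
  define D1 where "D1 = mat (1 / c) ** D"
  define P1 where "P1 = mat c ** fy (mat 1) ** q"
  have fx1: "fx x = B1 ** x ** D1" for x
    unfolding fx B1_def D1_def sc using c(1) by simp
  have B1: "unitary B1" and D1: "unitary D1" by (simp_all add: B1_def D1_def c)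
  have "adjoint_mat B1 ** (B1 ** qi) = qi"
    using B1 by (simp add: matrix_mul_assoc unitary_def)
  moreover have "B1 ** qi = mat c" by (simp add: B1_def ml qi)
  ultimately have qiB: "qi = mat c ** adjoint_mat B1" by (simp add: mat_mul_commute)
  have fy1: "fy y = P1 ** y ** adjoint_mat B1" for y
  proof -
    have "fy y = (fy (mat 1) ** q ** y) ** (mat c ** adjoint_mat B1)"
      by (simp only: hy[of y] hqy qiB matrix_mul_assoc)
    also have "\<dots> = mat c ** (fy (mat 1) ** q ** y ** adjoint_mat B1)" by (rule cm)
    finally show ?thesis by (simp only: P1_def matrix_mul_assoc)
  qed
  have P1: "unitary P1"
  proof -
    \<comment> \<open>Applying isometry of \<open>fy\<close> to \<open>y ** B1\<close> and
      \<open>B1\<close> cancels the right factor of \<open>fy\<close>.\<close>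
    have "mip y (adjoint_mat P1 ** P1) = mip y (mat 1)" for y
    proof -
      have "mip (fy (y ** B1)) (fy (mat 1 ** B1)) = mip (P1 ** y) (P1 ** mat 1)"
        using unitary_right[OF B1] by (simp add: fy1 flip: matrix_mul_assoc)
      then have "mip (P1 ** y) P1 = mip (y ** B1) (mat 1 ** B1)" by (simp add: iso)
      also have "\<dots> = mip y (mat 1)" using unitary_right[OF B1] by (simp add: mip_mul_right)
      finally show ?thesis by (simp add: mip_mul_left)
    qed
    then show ?thesis unfolding unitary_def by (rule mip_nondeg)
  qed
  \<comment> \<open>A common phase on \<open>P1\<close> and \<open>B1\<close>, with its inverse on
    \<open>D1\<close>, leaves \<open>fx\<close> and \<open>fy\<close> unchanged. The size is 2, so a
    square root of \<open>1 / det P1\<close> achieves \<open>det P = 1\<close>.\<close>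
  define e where "e = csqrt (cnj (det P1))"
  have e2: "e\<^sup>2 * det P1 = 1" using unitary_det[OF P1] by (simp add: e_def)
  have "cmod (det P1) = 1"
    using arg_cong[OF unitary_det[OF P1], of cmod] by (simp add: norm_mult abs_square_eq_1 flip: power2_eq_square)
  then have "cmod e = 1"
    using arg_cong[OF e2, of cmod] by (simp add: norm_mult norm_power abs_square_eq_1)
  then have ee: "cnj e * e = 1" by (simp add: mult.commute flip: complex_norm_square)
  then have e0: "e \<noteq> 0" by auto
  have um: "unitary (mat u ** U)" if "unitary U" "cnj u * u = 1" for U :: "complex^'k^'k" and u
    using that by (simp add: unitary_def adjoint_mat_mul mm flip: matrix_mul_assoc)
  define P where "P = mat e ** P1"
  define B where "B = mat e ** B1"
  define C where "C = transpose (mat (cnj e) ** D1)"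
  have u: "unitary P" "unitary B" "unitary C"
    using P1 B1 D1 ee by (auto simp: P_def B_def C_def mult.commute intro!: um unitary_transpose)
  have dP: "det P = 1" using e2 by (simp add: P_def det_2 power2_eq_square algebra_simps)
  have fxB: "fx x = B ** x ** transpose C" for x
    unfolding fx1 B_def C_def transpose_transpose sc using ee by (simp add: mult.commute)
  have fyB: "fy y = P ** y ** adjoint_mat B" for y
    unfolding fy1 B_def P_def adjoint_mat_mul adjoint_mat_mat mat_mul_commute[of "adjoint_mat B1"] sc
    using ee by (simp add: mult.commute)
  have fzB: "fz z = P ** z ** adjoint_mat C" for z
  proof -
    have C2: "transpose C ** transpose (adjoint_mat C) = mat 1"
      using u(3) by (metis matrix_transpose_mul transpose_mat unitary_def)
    have "alt (M ** transpose (fz z - P ** z ** adjoint_mat C)) = 0" for M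
    proof -
      \<comment> \<open>Solves \<open>fy (mat 1) ** fx x = M\<close>, so that invariance computes
        the pairing of an arbitrary \<open>M\<close> with \<open>fz z\<close>.\<close>
      define x where "x = adjoint_mat P ** M ** adjoint_mat (transpose C)"
      have M: "P ** x ** transpose C = M"
      proof -
        have "P ** x ** transpose C = (P ** adjoint_mat P) ** M ** (adjoint_mat (transpose C) ** transpose C)"
          by (simp add: x_def matrix_mul_assoc)
        then show ?thesis using unitary_right[OF u(1)] unitary_transpose[OF u(3)] by (simp add: unitary_def)
      qed
      have "fy (mat 1) ** fx x = P ** (adjoint_mat B ** B) ** x ** transpose C"
        by (simp add: fxB fyB matrix_mul_assoc)
      then have "fy (mat 1) ** fx x = M" using u(2) M by (simp add: unitary_def)
      then have 1: "alt (M ** transpose (fz z)) = alt (x ** transpose z)" using alt[of "mat 1" x z] by simp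
      have "M ** transpose (P ** z ** adjoint_mat C) = P ** x ** (transpose C ** transpose (adjoint_mat C)) ** transpose z ** transpose P"
        by (simp add: matrix_transpose_mul matrix_mul_assoc M)
      then have "M ** transpose (P ** z ** adjoint_mat C) = P ** (x ** transpose z) ** transpose P"
        by (simp add: C2 matrix_mul_assoc)
      then have 2: "alt (M ** transpose (P ** z ** adjoint_mat C)) = alt (x ** transpose z)"
        by (simp add: alt_congr dP)
      have "M ** transpose (a - b) = M ** transpose a - M ** transpose b" for a b :: "complex^'n^2"
        by (simp add: vec_eq_iff matrix_matrix_mult_def transpose_def right_diff_distrib sum_subtractf)
      then show ?thesis by (simp only: alt_diff 1 2 diff_self)
    qed
    then show ?thesis using alt_nondeg_left by fastforce
  qed
  show ?thesis by (rule that[OF u(1) dP u(2,3) fxB fyB fzB])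
qed

section \<open>Splitting along the joint eigenspaces\<close>

lemma eq_minus_self: "a = - a \<Longrightarrow> a = (0::'a::real_vector)"
  by (metis add.right_inverse scaleR_2 scaleR_eq_0_iff zero_neq_numeral)

lemma skew_0 [simp]: "skew 0"
  by (simp add: skew_def)

lemma skew_minus: "skew w \<Longrightarrow> skew (- w)"
  unfolding skew_def by (metis vector_uminus_component)

lemma mat_minus_1_mul: "mat (- 1) ** A = - (A :: complex^'n^'m)"
  by (simp add: vec_eq_iff)

lemma mscale_minus_jcoords: "mscale (- 1) (jcoords t w x y z) = jcoords (- t) (- w) (- x) (- y) (- z)"
  by (simp add: mscale_jcoords mat_minus_1_mul)

lemma mip_zero: "mip 0 A = 0" "mip A 0 = 0"
  by (simp_all add: mip_def)

lemma matrix_mul_zero: "A ** 0 = (0 :: complex^'n^'m)" "0 ** B = (0 :: complex^'n^'m)"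
  by (simp_all add: matrix_matrix_mult_def vec_eq_iff)

lemma transpose_zero: "transpose 0 = 0"
  by (simp add: transpose_def vec_eq_iff)

lemma E6_sigma_gammaD:
  assumes "\<alpha> \<in> carrier E6_sigma_gamma"
  shows "\<alpha> \<in> E6_set" "\<alpha> \<in> Bij jordanC"
    "\<And>X Y. X \<in> jordanC \<Longrightarrow> Y \<in> jordanC \<Longrightarrow> \<alpha> (X + Y) = \<alpha> X + \<alpha> Y"
    "\<And>c X. X \<in> jordanC \<Longrightarrow> \<alpha> (mscale c X) = mscale c (\<alpha> X)"
    "\<And>X Y. X \<in> jordanC \<Longrightarrow> Y \<in> jordanC \<Longrightarrow> jherm (\<alpha> X) (\<alpha> Y) = jherm X Y"
    "\<And>X. X \<in> jordanC \<Longrightarrow> jsigma (\<alpha> X) = \<alpha> (jsigma X)"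
    "\<And>X. X \<in> jordanC \<Longrightarrow> jgamma (\<alpha> X) = \<alpha> (jgamma X)"
    "\<And>X. X \<in> jordanC \<Longrightarrow> \<alpha> X \<in> jordanC"
  using assms by (auto simp: E6_sigma_gamma_def E6_def E6_set_def IsoC_def dest: Bij_imp_funcset)

text \<open>Commuting with the two sign changes makes every coordinate outside the original
  eigenspace equal to its own negative. The pair \<open>(t, w)\<close> is the common fixed space, so
  \<open>ft\<close> and \<open>fw\<close> may still depend on both.\<close>

lemma E6_sigma_gamma_components:
  assumes "\<alpha> \<in> carrier E6_sigma_gamma"
  obtains ft fw fx fy fz where
    "\<And>t w. skew w \<Longrightarrow> skew (fw t w)"
    "\<And>t w x y z. skew w \<Longrightarrow> \<alpha> (jcoords t w x y z) = jcoords (ft t w) (fw t w) (fx x) (fy y) (fz z)"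
proof -
  note a = E6_sigma_gammaD[OF assms]
  have tw: "\<exists>t' w'. skew w' \<and> \<alpha> (jcoords t w 0 0 0) = jcoords t' w' 0 0 0" for t w
  proof -
    obtain t' w' x' y' z' where w': "skew w'" "\<alpha> (jcoords t w 0 0 0) = jcoords t' w' x' y' z'"
      using a(8) by (meson jcoords_in_jordanC jordanC_cases)
    have "jsigma (\<alpha> (jcoords t w 0 0 0)) = \<alpha> (jcoords t w 0 0 0)" "jgamma (\<alpha> (jcoords t w 0 0 0)) = \<alpha> (jcoords t w 0 0 0)"
      by (simp_all add: a jsigma_jcoords jgamma_jcoords)
    then have "x' = 0" "y' = 0" "z' = 0"
      unfolding w' jsigma_jcoords jgamma_jcoords jcoords_inj[OF w'(1) w'(1)] by (metis eq_minus_self)+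
    with w' show ?thesis by auto
  qed
  have x: "\<exists>x'. \<alpha> (jcoords 0 0 x 0 0) = jcoords 0 0 x' 0 0" for x
  proof -
    obtain t' w' x' y' z' where w': "skew w'" "\<alpha> (jcoords 0 0 x 0 0) = jcoords t' w' x' y' z'"
      using a(8) by (meson jcoords_in_jordanC jordanC_cases)
    have "jsigma (\<alpha> (jcoords 0 0 x 0 0)) = mscale (-1) (\<alpha> (jcoords 0 0 x 0 0))" "jgamma (\<alpha> (jcoords 0 0 x 0 0)) = \<alpha> (jcoords 0 0 x 0 0)"
      using a(4)[of "jcoords 0 0 x 0 0" "-1"] by (simp_all add: a jsigma_jcoords jgamma_jcoords mscale_minus_jcoords)
    then have "t' = 0" "w' = 0" "y' = 0" "z' = 0"
      unfolding w' jsigma_jcoords jgamma_jcoords mscale_minus_jcoords jcoords_inj[OF w'(1) w'(1)] jcoords_inj[OF w'(1) skew_minus[OF w'(1)]]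
      by (metis eq_minus_self)+
    with w' show ?thesis by auto
  qed
  have y: "\<exists>y'. \<alpha> (jcoords 0 0 0 y 0) = jcoords 0 0 0 y' 0" for y
  proof -
    obtain t' w' x' y' z' where w': "skew w'" "\<alpha> (jcoords 0 0 0 y 0) = jcoords t' w' x' y' z'"
      using a(8) by (meson jcoords_in_jordanC jordanC_cases)
    have "jgamma (\<alpha> (jcoords 0 0 0 y 0)) = mscale (-1) (\<alpha> (jcoords 0 0 0 y 0))" "jsigma (\<alpha> (jcoords 0 0 0 y 0)) = \<alpha> (jcoords 0 0 0 y 0)"
      using a(4)[of "jcoords 0 0 0 y 0" "-1"] by (simp_all add: a jsigma_jcoords jgamma_jcoords mscale_minus_jcoords)
    then have "t' = 0" "w' = 0" "x' = 0" "z' = 0"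
      unfolding w' jsigma_jcoords jgamma_jcoords mscale_minus_jcoords jcoords_inj[OF w'(1) w'(1)] jcoords_inj[OF w'(1) skew_minus[OF w'(1)]]
      by (metis eq_minus_self)+
    with w' show ?thesis by auto
  qed
  have z: "\<exists>z'. \<alpha> (jcoords 0 0 0 0 z) = jcoords 0 0 0 0 z'" for z
  proof -
    obtain t' w' x' y' z' where w': "skew w'" "\<alpha> (jcoords 0 0 0 0 z) = jcoords t' w' x' y' z'"
      using a(8) by (meson jcoords_in_jordanC jordanC_cases)
    have "jgamma (\<alpha> (jcoords 0 0 0 0 z)) = mscale (-1) (\<alpha> (jcoords 0 0 0 0 z))" "jsigma (\<alpha> (jcoords 0 0 0 0 z)) = mscale (-1) (\<alpha> (jcoords 0 0 0 0 z))"
      using a(4)[of "jcoords 0 0 0 0 z" "-1"] by (simp_all add: a jsigma_jcoords jgamma_jcoords mscale_minus_jcoords)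
    then have "t' = 0" "w' = 0" "x' = 0" "y' = 0"
      unfolding w' jsigma_jcoords jgamma_jcoords mscale_minus_jcoords jcoords_inj[OF w'(1) w'(1)] jcoords_inj[OF w'(1) skew_minus[OF w'(1)]]
      by (metis eq_minus_self)+
    with w' show ?thesis by auto
  qed
  obtain ft fw where ftw: "skew (fw t w) \<and> \<alpha> (jcoords t w 0 0 0) = jcoords (ft t w) (fw t w) 0 0 0" for t w
    using tw by metis
  obtain fx where fx: "\<alpha> (jcoords 0 0 x 0 0) = jcoords 0 0 (fx x) 0 0" for x using x by metis
  obtain fy where fy: "\<alpha> (jcoords 0 0 0 y 0) = jcoords 0 0 0 (fy y) 0" for y using y by metis
  obtain fz where fz: "\<alpha> (jcoords 0 0 0 0 z) = jcoords 0 0 0 0 (fz z)" for z using z by metis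
  have "\<alpha> (jcoords t w x y z) = jcoords (ft t w) (fw t w) (fx x) (fy y) (fz z)" for t w x y z
  proof -
    have "jcoords t w x y z = jcoords t w 0 0 0 + jcoords 0 0 x 0 0 + jcoords 0 0 0 y 0 + jcoords 0 0 0 0 z"
      by (simp add: jcoords_add)
    then have "\<alpha> (jcoords t w x y z) = \<alpha> (jcoords t w 0 0 0) + \<alpha> (jcoords 0 0 x 0 0) + \<alpha> (jcoords 0 0 0 y 0) + \<alpha> (jcoords 0 0 0 0 z)"
      by (simp add: a jordanC_add)
    then show ?thesis by (simp add: ftw fx fy fz jcoords_add)
  qed
  with ftw show ?thesis using that by blast
qed

text \<open>For \<open>x\<close> with rows the unit vectors \<open>i\<close> and \<open>j\<close>,
  \<open>transpose x ** eps2 ** x\<close> is the corresponding basis bivector, against which the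
  polar form reads off one entry of \<open>n\<close> up to sign.\<close>

lemma pf4_polar_nondeg:
  assumes "skew n" and b: "\<And>x. pf4_polar n (transpose x ** eps2 ** x) = 0"
  shows "n = 0"
proof -
  define e where "e = (\<lambda>i j. (munit 1 i + munit 2 j) :: complex^4^2)"
  have m: "(transpose x ** eps2 ** x) $ k $ l = x $ 1 $ k * x $ 2 $ l - x $ 2 $ k * x $ 1 $ l" for x :: "complex^4^2" and k l
    by (simp add: matrix_matrix_mult_def sum_2 eps2_def transpose_def)
  have e: "e i j $ 1 $ k = (if k = i then 1 else 0)" "e i j $ 2 $ k = (if k = j then 1 else 0)" for i j k
    by (simp_all add: e_def munit_nth)
  show ?thesis
    using b[of "e 3 4"] b[of "e 2 4"] b[of "e 2 3"] b[of "e 1 4"] b[of "e 1 3"] b[of "e 1 2"]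
    unfolding pf4_polar_def m e
    using assms(1) by (simp add: skew_iffs vec_eq_iff forall_4)
qed

lemma phi_surj:
  assumes "\<alpha> \<in> carrier E6_sigma_gamma"
  shows "\<alpha> \<in> phi ` carrier (Sp1 \<times>\<times> S_U2_U4)"
proof -
  note a = E6_sigma_gammaD[OF assms]
  obtain ft fw fx fy fz where sk: "\<And>t w. skew w \<Longrightarrow> skew (fw t w)"
    and f: "\<And>t w x y z. skew w \<Longrightarrow> \<alpha> (jcoords t w x y z) = jcoords (ft t w) (fw t w) (fx x) (fy y) (fz z)"
    using E6_sigma_gamma_components[OF assms] by metis
  have add: "ft (t + t') (w + w') = ft t w + ft t' w' \<and> fw (t + t') (w + w') = fw t w + fw t' w' \<and>
      fx (x + x') = fx x + fx x' \<and> fy (y + y') = fy y + fy y' \<and> fz (z + z') = fz z + fz z'"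
    if w: "skew w" "skew w'" for t t' w w' x x' y y' z z'
  proof -
    have "\<alpha> (jcoords t w x y z + jcoords t' w' x' y' z') = \<alpha> (jcoords t w x y z) + \<alpha> (jcoords t' w' x' y' z')"
      by (simp add: a)
    then show ?thesis by (simp add: jcoords_add f w skew_add jcoords_inj sk)
  qed
  have scale: "ft (c * t) (mat c ** w) = c * ft t w \<and> fw (c * t) (mat c ** w) = mat c ** fw t w \<and>
      fx (mat c ** x) = mat c ** fx x \<and> fy (mat c ** y) = mat c ** fy y \<and> fz (mat c ** z) = mat c ** fz z"
    if w: "skew w" for c t w x y z
  proof -
    have "\<alpha> (mscale c (jcoords t w x y z)) = mscale c (\<alpha> (jcoords t w x y z))" by (simp add: a)
    then show ?thesis by (simp add: mscale_jcoords f w skew_mat_mul jcoords_inj sk)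
  qed
  have zero: "ft 0 0 = 0" "fw 0 0 = 0" "fx 0 = 0" "fy 0 = 0" "fz 0 = 0"
    using add[of 0 0 0 0 0 0 0 0 0 0] by auto
  have herm: "cnj (ft t w) * ft t' w' + mip (fw t w) (fw t' w') / 2 + mip (fx x) (fx x') + mip (fy y) (fy y') + mip (fz z) (fz z')
     = cnj t * t' + mip w w' / 2 + mip x x' + mip y y' + mip z z'"
    if w: "skew w" "skew w'" for t t' w w' x x' y y' z z'
    using a(5)[of "jcoords t w x y z" "jcoords t' w' x' y' z'"] by (simp add: f w sk jherm_jcoords)
  have cub: "jcub (ft t w) (fw t w) (fx x) (fy y) (fz z) = jcub t w x y z" if w: "skew w" for t w x y z
    using E6_cubic[OF a(1), of "jcoords t w x y z"] by (simp add: f w sk jtri_jcoords)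
  have surj: "\<exists>t' w' x' y' z'. skew w' \<and> ft t' w' = t \<and> fw t' w' = w \<and> fx x' = x \<and> fy y' = y \<and> fz z' = z"
    if w: "skew w" for t w x y z
  proof -
    have "jcoords t w x y z \<in> \<alpha> ` jordanC" using a(2) by (simp add: Bij_def bij_betw_def)
    then obtain X where X: "jcoords t w x y z = \<alpha> X" "X \<in> jordanC" by (rule imageE)
    obtain t' w' x' y' z' where w': "skew w'" "X = jcoords t' w' x' y' z'" using X(2) by (rule jordanC_cases)
    then have "jcoords t w x y z = jcoords (ft t' w') (fw t' w') (fx x') (fy y') (fz z')" using X f by simp
    then show ?thesis using w w' sk[OF w'(1)] by (auto simp: jcoords_inj)
  qed
  have pf4_polar0: "pf4_polar w 0 = 0" "pf4_polar 0 w = 0" "pf4 0 = 0" "alt 0 = 0" for w by (simp_all add: pf4_polar_def pf4_def alt_def)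
  have det0: "det (0 :: complex^2^2) = 0" by (simp add: det_2)
  note z0 = zero mip_zero matrix_mul_zero transpose_zero pf4_polar0 det0

  \<comment> \<open>Setting blocks to zero isolates terms of the determinant: these two instances
    differ exactly in the term \<open>t * det y\<close>. The trilinear \<open>alt\<close> term is
    isolated in the same way below.\<close>
  have tdet: "ft t w * det (fy y) = t * det y" if w: "skew w" for t w y
    using cub[OF w, of t 0 y 0] cub[OF w, of t 0 0 0] by (simp add: jcub_def z0)
  have isox: "mip (fx x) (fx x') = mip x x'" for x x'
    using herm[of 0 0 0 0 x x' 0 0 0 0] by (simp add: z0)
  have isoy: "mip (fy y) (fy y') = mip y y'" for y y'
    using herm[of 0 0 0 0 0 0 y y' 0 0] by (simp add: z0)
  have lin: "clin_mat fx"
    unfolding clin_mat_def using add[of 0 0] scale[of 0] by simp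
  have surjz: "surj fz" unfolding surj_def using surj[of 0] by (metis skew_0)
  have alt: "alt (fy y ** fx x ** transpose (fz z)) = alt (y ** x ** transpose z)" for x y z
    using cub[of 0 0 x y z] cub[of 0 0 x 0 0] by (simp add: jcub_def z0)
  have det1: "det (fy (mat 1)) \<noteq> 0"
    using tdet[of 0 1 "mat 1"] by auto
  obtain P B C where P: "unitary P" "det P = 1" and B: "unitary B" and C: "unitary C"
    and fx: "\<And>x. fx x = B ** x ** transpose C" and fy: "\<And>y. fy y = P ** y ** adjoint_mat B"
    and fz: "\<And>z. fz z = P ** z ** adjoint_mat C"
    using intertwining_triple[OF lin isox isoy surjz det1 alt] by metis

  have ft: "ft t w = det B * t" if w: "skew w" for t w
  proof -
    have "ft t w * cnj (det B) = t"
      using tdet[OF w, of t "mat 1"] by (simp add: fy det_mul P det_adjoint_mat)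
    then show ?thesis using unitary_det[OF B] by (metis mult.assoc mult.commute mult_1)
  qed
  have dB: "det B \<noteq> 0" "det C \<noteq> 0" using unitary_det[OF B] unitary_det[OF C] by auto
  have fwt: "fw t 0 = 0" for t
  proof -
    \<comment> \<open>The vector with coordinates \<open>(0, fw t 0)\<close> has a preimage
      \<open>(0, w')\<close>. This is orthogonal to \<open>(t, 0)\<close>, so \<open>fw t 0\<close>
      is orthogonal to itself.\<close>
    obtain t' w' where w': "skew w'" "ft t' w' = 0" "fw t' w' = fw t 0" using surj[OF sk[OF skew_0]] by meson
    then have "t' = 0" using ft dB by simp
    then have "mip (fw t 0) (fw t 0) = 0"
      using herm[of 0 w' t 0 0 0 0 0 0 0] w' by (simp add: z0 ft)
    then show ?thesis using mip_self_eq_0[of "fw t 0"] by simp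
  qed
  have fwtw: "fw t w = fw 0 w" if "skew w" for t w
    using add[of 0 w t 0] that by (simp add: fwt)
  \<comment> \<open>The mixed term in \<open>w\<close> and \<open>x\<close> determines
    \<open>fw\<close> with this factor; that it equals 1 comes only from the term
    \<open>t * pf4 w\<close>.\<close>
  define k where "k = 1 / (det B * det C)"
  have fw: "fw t w = mat k ** (C ** w ** transpose C)" if w: "skew w" for t w
  proof -
    define n where "n = fw 0 w + mat (- k) ** (C ** w ** transpose C)"
    have "n = 0"
    proof (rule pf4_polar_nondeg)
      show "skew n" unfolding n_def by (intro skew_add skew_mat_mul skew_congr sk w)
      fix x :: "complex^4^2"
      \<comment> \<open>The preimage of \<open>x\<close> under \<open>fx\<close>, so that an
        arbitrary \<open>x\<close> can be tested against \<open>n\<close>.\<close>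
      define x' where "x' = adjoint_mat B ** x ** adjoint_mat (transpose C)"
      have "B ** x' ** transpose C = (B ** adjoint_mat B) ** x ** (adjoint_mat (transpose C) ** transpose C)"
        by (simp add: x'_def matrix_mul_assoc)
      then have x: "B ** x' ** transpose C = x"
        using unitary_right[OF B] unitary_transpose[OF C] by (simp add: unitary_def)
      let ?h = "transpose x' ** eps2 ** x'"
      have 1: "transpose x ** eps2 ** x = mat (det B) ** (C ** ?h ** transpose C)"
        using transpose_eps2_congr[of B x' C] unfolding x .
      have 2: "pf4_polar (fw 0 w) (transpose x ** eps2 ** x) = pf4_polar w ?h"
        using cub[OF w, of 0 x' 0 0] ft[OF w, of 0] by (simp add: jcub_def z0 fx x)
      have 3: "pf4_polar (C ** w ** transpose C) (transpose x ** eps2 ** x) = det B * det C * pf4_polar w ?h"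
        by (simp add: 1 pf4_polar_congr w skew_eps2_congr)
      have "pf4_polar n h = pf4_polar (fw 0 w) h + pf4_polar (mat (- k) ** (C ** w ** transpose C)) h" for h
        by (simp add: n_def pf4_polar_def algebra_simps)
      then have "pf4_polar n (transpose x ** eps2 ** x) = pf4_polar w ?h - k * (det B * det C * pf4_polar w ?h)"
        by (simp add: 2 3)
      then show "pf4_polar n (transpose x ** eps2 ** x) = 0" using dB by (simp add: k_def)
    qed
    then have "fw 0 w = mat k ** (C ** w ** transpose C)"
      unfolding n_def by (simp add: vec_eq_iff)
    then show ?thesis using fwtw[OF w] by simp
  qed
  have BC: "det B * det C = 1"
  proof -
    \<comment> \<open>Two diagonal copies of \<open>eps2\<close>, a skew matrix with Pfaffian
      1.\<close>
    define w :: "complex^4^4" where "w = munit 1 2 + (- munit 2 1) + (munit 3 4 + (- munit 4 3))"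
    have w: "skew w" "pf4 w = 1"
      unfolding skew_iffs pf4_def w_def by (simp_all add: munit_nth)
    have "det B * (k\<^sup>2 * det C) = 1"
      using cub[OF w(1), of 1 0 0 0] by (simp add: jcub_def z0 ft fw w pf4_congr)
    then have "k\<^sup>2 * (det B * det C) = 1" by (simp add: mult_ac)
    then show ?thesis using dB by (simp add: k_def field_simps power2_eq_square)
  qed
  then have k: "k = 1" by (simp add: k_def)

  obtain p where p: "p \<in> carrier Sp1" "P = quat_mat p" using quat_mat_surj[OF P] .
  obtain A :: mat6 where A: "bdiag A" "blkl A = B" "blkr A = C" using bdiag_exists by blast
  have "A \<in> carrier S_U2_U4" by (simp add: S_U2_U4_iff A B C BC)
  moreover have "\<alpha> = phi (p, A)"
  proof
    fix X
    show "\<alpha> X = phi (p, A) X"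
    proof (cases "X \<in> jordanC")
      case True
      then obtain t w x y z where w: "skew w" "X = jcoords t w x y z" by (rule jordanC_cases)
      then show ?thesis by (simp add: phi_def A jact_jcoords f ft fw k fx fy fz flip: p(2))
    next
      case False
      then show ?thesis using Bij_imp_extensional[OF a(2)] by (simp add: phi_def jact_def extensional_def)
    qed
  qed
  ultimately show ?thesis using p(1) by auto
qed

section \<open>Kernel and topology\<close>

text \<open>A continuous map from a compact space to a Hausdorff space is closed, so
  \<open>h\<close>, being onto, is a quotient map. The induced bijection on cosets inherits this,
  and an injective quotient map is a homeomorphism.\<close>

lemma lie_iso_compact_quotient:
  fixes G :: "('a::topological_space, 'c) monoid_scheme" and H :: "('b::topological_space, 'd) monoid_scheme"
  assumes gh: "group_hom G H h" and onto: "h ` carrier G = carrier H" and comp: "compact (carrier G)"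
    and cont: "continuous_on (carrier G) h" and haus: "Hausdorff_space (top_of_set (carrier H))"
  shows "lie_iso (G Mod kernel G H h) (coset_topology G (kernel G H h) (top_of_set (carrier G)))
    H (top_of_set (carrier H))"
proof -
  interpret group_hom G H h by (rule gh)
  let ?K = "kernel G H h" and ?T = "top_of_set (carrier G)" and ?S = "top_of_set (carrier H)"
  let ?Q = "coset_topology G ?K ?T"
  define f where "f = (\<lambda>X. the_elem (h ` X))"
  have iso: "f \<in> iso (G Mod ?K) H" unfolding f_def by (rule FactGroup_iso_set[OF onto])
  note open_Q = openin_coset_topology[OF G.is_group subgroup_kernel, of ?T]
  have hX: "h x = f X" if X: "X \<in> carrier (G Mod ?K)" "x \<in> X" for x X
  proof -
    have "h ` X = {h x}"
      using X by (auto simp: FactGroup_def RCOSETS_def r_coset_def kernel_def)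
    then show ?thesis by (simp add: f_def)
  qed
  have sub: "\<Union>(carrier (G Mod ?K)) = carrier G"
    using G.rcosets_part_G[OF subgroup_kernel] by (simp add: FactGroup_def)
  have "openin ?Q (carrier (G Mod ?K))" unfolding open_Q by (simp add: sub)
  then have top: "topspace ?Q = carrier (G Mod ?K)"
    by (metis open_Q openin_subset openin_topspace subset_antisym)
  have "continuous_map ?T ?S h" using cont onto by (auto simp: continuous_map_in_subtopology)
  moreover have "compact_space ?T" using comp by (simp add: compact_space_subtopology)
  ultimately have quot: "quotient_map ?T ?S h"
    using haus onto by (intro continuous_closed_imp_quotient_map continuous_imp_closed_map) auto
  have "quotient_map ?Q ?S f"
    unfolding quotient_map_def
  proof (intro conjI allI impI)
    show "f ` topspace ?Q = topspace ?S"
      using iso by (simp add: top iso_def bij_betw_def)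
    fix V assume V: "V \<subseteq> topspace ?S"
    \<comment> \<open>The cosets that \<open>f\<close> sends into \<open>V\<close> fill exactly the
      preimage of \<open>V\<close> under \<open>h\<close>, so openness of either set is the same
      condition.\<close>
    have "\<Union>{X \<in> topspace ?Q. f X \<in> V} = {x \<in> topspace ?T. h x \<in> V}"
    proof (intro equalityI subsetI)
      fix x assume "x \<in> \<Union>{X \<in> topspace ?Q. f X \<in> V}"
      then show "x \<in> {x \<in> topspace ?T. h x \<in> V}" using hX sub by (auto simp: top)
    next
      fix x assume x: "x \<in> {x \<in> topspace ?T. h x \<in> V}"
      then obtain X where X: "X \<in> carrier (G Mod ?K)" "x \<in> X" using sub by auto
      then show "x \<in> \<Union>{X \<in> topspace ?Q. f X \<in> V}" using hX[OF X] x by (auto simp: top)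
    qed
    then have "openin ?Q {X \<in> topspace ?Q. f X \<in> V} \<longleftrightarrow> openin ?T {x \<in> topspace ?T. h x \<in> V}"
      unfolding open_Q by (auto simp: top)
    also have "\<dots> \<longleftrightarrow> openin ?S V" using quot V unfolding quotient_map_def by blast
    finally show "openin ?Q {X \<in> topspace ?Q. f X \<in> V} \<longleftrightarrow> openin ?S V" .
  qed
  moreover have "inj_on f (topspace ?Q)" using iso by (simp add: top iso_def bij_betw_def)
  ultimately have "homeomorphic_map ?Q ?S f" unfolding homeomorphic_map_def by blast
  with iso show ?thesis unfolding lie_iso_def by blast
qed

lemma Hausdorff_top_of_set_fun: "Hausdorff_space (top_of_set (S :: ('a \<Rightarrow> 'b::metric_space) set))"
proof -
  have "Hausdorff_space (product_topology (\<lambda>_ :: 'a. euclidean :: 'b topology) UNIV)"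
    unfolding Hausdorff_space_product_topology by simp
  then show ?thesis unfolding euclidean_product_topology by (rule Hausdorff_space_subtopology)
qed

section \<open>The kernel\<close>

lemma quat_mat_eq_mat: "p \<in> carrier Sp1 \<Longrightarrow> quat_mat p = mat c \<Longrightarrow> (p = qone \<and> c = 1) \<or> (p = - qone \<and> c = - 1)"
proof -
  assume p: "p \<in> carrier Sp1" and c: "quat_mat p = mat c"
  obtain a1 a2 a3 a4 where q: "p = (a1, a2, a3, a4)" by (metis surj_pair)
  have "Complex a1 a2 = c" "Complex a3 a4 = 0" "Complex a1 (- a2) = c"
    using arg_cong[OF c, of "\<lambda>M. M$1$1"] arg_cong[OF c, of "\<lambda>M. M$1$2"] arg_cong[OF c, of "\<lambda>M. M$2$2"]
    by (simp_all add: quat_mat_def q mat_def)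
  then have "a2 = 0 \<and> a3 = 0 \<and> a4 = 0 \<and> c = of_real a1"
    by (auto simp: complex_eq_iff)
  moreover have "a1\<^sup>2 + a2\<^sup>2 + a3\<^sup>2 + a4\<^sup>2 = 1" using p by (simp add: q Sp1_iff)
  ultimately show ?thesis by (auto simp: q qone_def power2_eq_1_iff)
qed

lemma quat_mat_uminus: "quat_mat (- p) = - quat_mat p"
  by (cases p) (simp add: quat_mat_def vec_eq_iff forall_2 complex_eq_iff)

lemma quat_mat_qone: "quat_mat qone = mat 1"
  by (simp add: quat_mat_def qone_def vec_eq_iff forall_2 mat_def complex_eq_iff)

lemma mat_uminus: "mat (- c) = (- mat c :: complex^'n^'n)"
  by (simp add: mat_def vec_eq_iff)

lemma unitary_minus_1: "unitary (- mat 1 :: complex^'n^'n)"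
proof -
  have "adjoint_mat (- mat 1 :: complex^'n^'n) = - mat 1"
    unfolding mat_uminus[symmetric] adjoint_mat_mat by simp
  then show "unitary (- mat 1 :: complex^'n^'n)"
    by (simp add: unitary_def matrix_uminus_left matrix_uminus_right)
qed

lemma Z2_subset: "Z2 \<subseteq> carrier (Sp1 \<times>\<times> S_U2_U4)"
proof -
  have d2: "det (- mat 1 :: complex^2^2) = 1" by (simp add: det_2 mat_def)
  have d4: "det (- mat 1 :: complex^4^4) = 1" by (simp add: det_4 mat_def)
  have b: "bdiag (- mat 1 :: mat6)" "blkl (- mat 1 :: mat6) = - mat 1" "blkr (- mat 1 :: mat6) = - mat 1"
    by (simp_all flip: mat_uminus)
  show ?thesis
    unfolding Z2_def by (auto simp: S_U2_U4_iff d2 d4 b unitary_minus_1 unitary_def[of "mat 1"] Sp1_def qone_def)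
qed

lemma one_E6_sigma_gamma: "\<one>\<^bsub>E6_sigma_gamma\<^esub> = (\<lambda>X\<in>jordanC. X)"
  by (simp add: E6_sigma_gamma_def E6_def BijGroup_def)

text \<open>On matrix units the relation kills the off-diagonal entries and equates every diagonal
  entry of \<open>P\<close> with every one of \<open>B\<close>.\<close>

lemma scalar_intertwiner:
  fixes P :: "complex^'m^'m" and B :: "complex^'n^'n"
  assumes "\<And>y. P ** y = y ** B"
  obtains c where "P = mat c" "B = mat c"
proof -
  have *: "(if j = b then P $ i $ a else 0) = (if i = a then B $ b $ j else 0)" for i a b j
    using arg_cong[OF assms[of "munit a b"], of "\<lambda>M. M $ i $ j"] by (simp only: munit_mul_left munit_mul_right)
  obtain a :: 'm and b :: 'n where True by simp
  define c where "c = P $ a $ a"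
  have "P $ i $ a' = (if i = a' then c else 0)" for i a'
    using *[of b b i a'] *[of b b a a] by (auto simp: c_def)
  moreover have "B $ b' $ j = (if b' = j then c else 0)" for b' j
    using *[of j b' a a] by (auto simp: c_def)
  ultimately have "P = mat c" "B = mat c"
    by (simp_all add: vec_eq_iff mat_def)
  then show ?thesis by (rule that)
qed

text \<open>The blocks \<open>y\<close> and \<open>z\<close> suffice: fixing them makes the
  quaternion matrix intertwine with both diagonal blocks, so all three are the same scalar, and a
  unit quaternion with scalar matrix is \<open>qone\<close> or its negative.\<close>

lemma kernel_phi: "kernel (Sp1 \<times>\<times> S_U2_U4) E6_sigma_gamma phi = Z2"
proof (intro equalityI subsetI)
  fix u assume u: "u \<in> kernel (Sp1 \<times>\<times> S_U2_U4) E6_sigma_gamma phi"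
  obtain p A where pA: "u = (p, A)" by fastforce
  have p: "p \<in> carrier Sp1" and A: "bdiag A" "unitary (blkl A)" "unitary (blkr A)"
    using u by (auto simp: pA kernel_def S_U2_U4_iff)
  have "phi (p, A) (jcoords 0 0 0 y z) = jcoords 0 0 0 y z" for y z
    using u by (simp add: pA kernel_def one_E6_sigma_gamma)
  then have yz: "quat_mat p ** y ** adjoint_mat (blkl A) = y" "quat_mat p ** z ** adjoint_mat (blkr A) = z" for y z
    by (auto simp: phi_def jact_jcoords jcoords_inj skew_congr)
  have "quat_mat p ** y = y ** blkl A" for y
    using arg_cong[OF yz(1)[of y], of "\<lambda>M. M ** blkl A"] A(2) by (simp add: unitary_def flip: matrix_mul_assoc)
  then obtain c where c: "quat_mat p = mat c" "blkl A = mat c" by (rule scalar_intertwiner)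
  have "quat_mat p ** z = z ** blkr A" for z
    using arg_cong[OF yz(2)[of z], of "\<lambda>M. M ** blkr A"] A(3) by (simp add: unitary_def flip: matrix_mul_assoc)
  then obtain c' where c': "quat_mat p = mat c'" "blkr A = mat c'" by (rule scalar_intertwiner)
  have "c' = c" using arg_cong[OF c'(1)[unfolded c(1)], of "\<lambda>M. M $ 1 $ 1"] by (simp add: mat_def)
  then have "A = mat c" using c c' A(1) by (subst bdiag_eq_iff) auto
  with quat_mat_eq_mat[OF p c(1)] show "u \<in> Z2"
    by (auto simp: Z2_def pA mat_uminus)
next
  fix u assume u: "u \<in> Z2"
  have b: "blkl (- mat 1 :: mat6) = mat (- 1)" "blkr (- mat 1 :: mat6) = mat (- 1)" 
    by (simp_all flip: mat_uminus)
  have P: "quat_mat (- qone) = mat (- 1)" by (simp add: quat_mat_uminus quat_mat_qone mat_uminus)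
  have d: "det (mat (- 1) :: complex^2^2) = 1" by (simp add: det_2 mat_def)
  have m: "A ** mat (- 1) = - A" for A :: "complex^'n^'m" by (simp add: mat_mul_commute mat_minus_1_mul)
  have "phi (- qone, - mat 1) = (\<lambda>X\<in>jordanC. X)"
  proof
    fix X show "phi (- qone, - mat 1) X = (\<lambda>X\<in>jordanC. X) X"
    proof (cases "X \<in> jordanC")
      case True
      then show ?thesis
        by (elim jordanC_cases)
          (simp add: phi_def b P jact_jcoords d transpose_mat mat_mul_commute mat_minus_1_mul)
    qed (simp add: phi_def jact_def)
  qed
  moreover have "phi (qone, mat 1) = (\<lambda>X\<in>jordanC. X)"
  proof
    fix X show "phi (qone, mat 1) X = (\<lambda>X\<in>jordanC. X) X"
      by (cases "X \<in> jordanC") (simp_all add: phi_def quat_mat_qone jact_1, simp add: jact_def)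
  qed
  ultimately show "u \<in> kernel (Sp1 \<times>\<times> S_U2_U4) E6_sigma_gamma phi"
    using u Z2_subset unfolding kernel_def one_E6_sigma_gamma by (auto simp: Z2_def)
qed

text \<open>Surjectivity makes the target the image of a group under a homomorphism, so it is a
  group itself.\<close>

lemma group_hom_phi: "group_hom (Sp1 \<times>\<times> S_U2_U4) E6_sigma_gamma phi"
proof -
  interpret G: group "Sp1 \<times>\<times> S_U2_U4" by (intro DirProd_group group_Sp1 group_S_U2_U4)
  have im: "phi ` carrier (Sp1 \<times>\<times> S_U2_U4) = carrier E6_sigma_gamma"
    using phi_closed phi_surj by blast
  have "(qone, mat 1) \<in> kernel (Sp1 \<times>\<times> S_U2_U4) E6_sigma_gamma phi"
    by (simp add: kernel_phi Z2_def)
  then have one: "phi \<one>\<^bsub>Sp1 \<times>\<times> S_U2_U4\<^esub> = \<one>\<^bsub>E6_sigma_gamma\<^esub>"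
    by (simp add: kernel_def Sp1_def S_U2_U4_def SU6_def)
  have "group (E6_sigma_gamma \<lparr>carrier := phi ` carrier (Sp1 \<times>\<times> S_U2_U4), one := phi \<one>\<^bsub>Sp1 \<times>\<times> S_U2_U4\<^esub>\<rparr>)"
    by (rule G.hom_imp_img_group[OF phi_hom])
  then have "group E6_sigma_gamma" unfolding im one by simp
  then show ?thesis
    by (simp add: group_hom_def group_hom_axioms_def G.is_group phi_hom)
qed

section \<open>Continuity and compactness\<close>

lemma continuous_on_matrix_mult [continuous_intros]:
  fixes f :: "'a::topological_space \<Rightarrow> complex^'n^'m" and g :: "'a \<Rightarrow> complex^'k^'n"
  assumes "continuous_on S f" "continuous_on S g"
  shows "continuous_on S (\<lambda>x. f x ** g x)"
  unfolding matrix_matrix_mult_def by (intro continuous_intros assms)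

lemma continuous_on_transpose [continuous_intros]:
  fixes f :: "'a::topological_space \<Rightarrow> complex^'n^'m"
  assumes "continuous_on S f"
  shows "continuous_on S (\<lambda>x. transpose (f x))"
  unfolding transpose_def by (intro continuous_intros assms)

lemma continuous_on_adjoint_mat [continuous_intros]:
  assumes "continuous_on S f"
  shows "continuous_on S (\<lambda>x. adjoint_mat (f x))"
  unfolding adjoint_mat_def by (intro continuous_intros assms)

lemma continuous_on_det_complex [continuous_intros]:
  fixes f :: "'a::topological_space \<Rightarrow> complex^'n^'n"
  assumes "continuous_on S f"
  shows "continuous_on S (\<lambda>x. det (f x))"
  unfolding det_def by (intro continuous_intros assms)

lemma continuous_on_blk [continuous_intros]:
  fixes f :: "'a::topological_space \<Rightarrow> complex^('m::finite + 'n::finite)^('m + 'n)"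
  assumes "continuous_on S f"
  shows "continuous_on S (\<lambda>x. blkl (f x))" "continuous_on S (\<lambda>x. blkr (f x))"
  unfolding blkl_def blkr_def by (intro continuous_intros assms)+

lemma continuous_on_pm [continuous_intros]:
  assumes "continuous_on S f"
  shows "continuous_on S (\<lambda>x. quat_mat (f x))"
proof -
  have "linear quat_mat"
  proof (rule linearI)
    show "quat_mat (p + q) = quat_mat p + quat_mat q" for p q
      by (cases p, cases q) (simp add: quat_mat_def vec_eq_iff forall_2 complex_eq_iff)
    show "quat_mat (r *\<^sub>R p) = r *\<^sub>R quat_mat p" for r p
      by (cases p) (simp add: quat_mat_def vec_eq_iff forall_2 complex_eq_iff)
  qed
  then have "continuous_on UNIV quat_mat" by (simp add: linear_continuous_on linear_conv_bounded_linear)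
  then show ?thesis using continuous_on_compose2[OF _ assms] by blast
qed

text \<open>The map is jointly real-linear in its five arguments, which range over a
  finite-dimensional space.\<close>

lemma continuous_on_jcoords [continuous_intros]:
  assumes "continuous_on S t" "continuous_on S w" "continuous_on S x" "continuous_on S y" "continuous_on S z"
  shows "continuous_on S (\<lambda>s. jcoords (t s) (w s) (x s) (y s) (z s))"
proof -
  let ?L = "\<lambda>(t, w, x, y, z). jcoords t w x y z"
  have sc: "cscale (of_real r) v = r *\<^sub>R v" for r and v :: cayleyC by (cases v) (simp add: zero_prod_def)
  have "linear ?L"
  proof (rule linearI)
    show "?L (u + v) = ?L u + ?L v" for u v
      by (cases u, cases v) (simp add: jcoords_add)
    have "r *\<^sub>R X = mscale (of_real r) X" for r X
      by (simp add: mscale_def sc vec_eq_iff)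
    moreover have "mat (of_real r) ** A = r *\<^sub>R A" for r and A :: "complex^4^4"
      by (simp add: vec_eq_iff scaleR_conv_of_real[where 'a = complex])
    moreover have "mat (of_real r) ** A = r *\<^sub>R A" for r and A :: "complex^4^2"
      by (simp add: vec_eq_iff scaleR_conv_of_real[where 'a = complex])
    moreover have "mat (of_real r) ** A = r *\<^sub>R A" for r and A :: "complex^2^2"
      by (simp add: vec_eq_iff scaleR_conv_of_real[where 'a = complex])
    ultimately show "?L (r *\<^sub>R u) = r *\<^sub>R ?L u" for r u
      by (cases u) (simp add: mscale_jcoords scaleR_conv_of_real[where 'a = complex])
  qed
  then have "continuous_on UNIV ?L" by (simp add: linear_continuous_on linear_conv_bounded_linear)
  moreover have "continuous_on S (\<lambda>s. (t s, w s, x s, y s, z s))" by (intro continuous_intros assms)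
  ultimately have "continuous_on S (\<lambda>s. ?L (t s, w s, x s, y s, z s))"
    by (rule continuous_on_compose2) auto
  then show ?thesis by simp
qed

text \<open>The topology is pointwise convergence, so one fixed \<open>X\<close> is enough. Its
  image is built from continuous matrix operations, and off \<open>jordanC\<close> the value is
  constantly \<open>undefined\<close>.\<close>

lemma continuous_on_phi: "continuous_on S phi"
proof (rule continuous_on_coordinatewise_then_product)
  fix X
  show "continuous_on S (\<lambda>u. phi u X)"
  proof (cases "X \<in> jordanC")
    case True
    then obtain t w x y z where w: "skew w" "X = jcoords t w x y z" by (rule jordanC_cases)
    have "phi u X = jcoords (det (blkl (snd u)) * t) (blkr (snd u) ** w ** transpose (blkr (snd u)))
      (blkl (snd u) ** x ** transpose (blkr (snd u))) (quat_mat (fst u) ** y ** adjoint_mat (blkl (snd u)))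
      (quat_mat (fst u) ** z ** adjoint_mat (blkr (snd u)))" for u
      by (cases u) (simp add: phi_def w jact_jcoords)
    then show ?thesis by (simp only:) (intro continuous_intros)
  next
    case False
    then have u: "phi u X = undefined" for u by (cases u) (simp add: phi_def jact_def)
    show ?thesis unfolding u by (rule continuous_on_const)
  qed
qed

lemma compact_Sp1: "compact (carrier Sp1)"
proof -
  have "carrier Sp1 = sphere 0 1"
    by (auto simp: Sp1_iff norm_prod_def)
  then show ?thesis by simp
qed

lemma compact_S_U2_U4: "compact (carrier S_U2_U4)"
proof -
  have eq: "carrier S_U2_U4 = {A. adjoint_mat A ** A = mat 1 \<and> det A = 1 \<and>
      (\<forall>i j. A $ Inl i $ Inr j = 0 \<and> A $ Inr j $ Inl i = 0)}"
    by (auto simp: S_U2_U4_def SU6_def)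
  have "closed (carrier S_U2_U4)"
    unfolding eq by (intro closed_Collect_conj closed_Collect_all closed_Collect_eq continuous_intros)
  moreover have "bounded (carrier S_U2_U4)"
  proof -
    \<comment> \<open>Columns of a unitary matrix are unit vectors, so each of the 36 entries has
      modulus at most 1, and their sum bounds the norm.\<close>
    have "norm A \<le> 36" if "A \<in> carrier S_U2_U4" for A
    proof -
      have e: "norm (A $ i $ j) \<le> 1" for i j
      proof -
        have "of_real (\<Sum>k\<in>UNIV. (cmod (A $ k $ j))\<^sup>2) = (adjoint_mat A ** A) $ j $ j"
          by (simp add: matrix_matrix_mult_def mult.commute flip: complex_norm_square)
        also have "\<dots> = 1" using that by (simp add: eq mat_def)
        finally have "(\<Sum>k\<in>UNIV. (cmod (A $ k $ j))\<^sup>2) = 1" by (metis of_real_eq_1_iff)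
        then have "(cmod (A $ i $ j))\<^sup>2 \<le> 1"
          using member_le_sum[of i UNIV "\<lambda>k. (cmod (A $ k $ j))\<^sup>2"] by simp
        then show ?thesis by (simp add: abs_square_le_1)
      qed
      have "norm A \<le> (\<Sum>i\<in>UNIV. norm (A $ i))" by (simp add: norm_vec_def L2_set_le_sum)
      also have "\<dots> \<le> (\<Sum>i\<in>(UNIV :: (2 + 4) set). \<Sum>j\<in>(UNIV :: (2 + 4) set). norm (A $ i $ j))"
        by (intro sum_mono) (simp add: norm_vec_def L2_set_le_sum)
      also have "\<dots> \<le> (\<Sum>i\<in>(UNIV :: (2 + 4) set). \<Sum>j\<in>(UNIV :: (2 + 4) set). 1)"
        by (intro sum_mono e)
      finally show ?thesis by simp
    qed
    then show ?thesis unfolding bounded_iff by blast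
  qed
  ultimately show ?thesis by (simp add: compact_eq_bounded_closed)
qed

theorem theorem2p3:
  shows "lie_iso
    ((Sp1 \<times>\<times> S_U2_U4) Mod Z2)
    (coset_topology (Sp1 \<times>\<times> S_U2_U4) Z2 (top_of_set (carrier (Sp1 \<times>\<times> S_U2_U4))))
    E6_sigma_gamma
    (top_of_set (carrier E6_sigma_gamma))"
proof -
  have "phi ` carrier (Sp1 \<times>\<times> S_U2_U4) = carrier E6_sigma_gamma"
    using phi_closed phi_surj by blast
  moreover have "compact (carrier (Sp1 \<times>\<times> S_U2_U4))"
    using compact_Times[OF compact_Sp1 compact_S_U2_U4] by (simp add: DirProd_def)
  ultimately show ?thesis
    unfolding kernel_phi[symmetric]
    by (intro lie_iso_compact_quotient group_hom_phi continuous_on_phi Hausdorff_top_of_set_fun)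
qed

end
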